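(* Let $n=\ell+3\ge4$ and $|S|=n$. The de Rham cohomology of $B(\mathfrak{M}_{0,S})$ is trivial: $$H^i_{\mathrm{DR}}(B(\mathfrak{M}_{0,S}))=0\qquad\text{for all } i\ge1.$$
   Context: $\mathfrak{M}_{0,S}$ is the moduli space of genus $0$ curves with $n$ marked points labelled by $S$; placing three of the points at $1,\infty,0$ identifies it with the hyperplane complement over $k=\mathbb{Q}$ $$\mathfrak{M}_{0,S}\cong\{(t_1,\ldots,t_\ell)\in\mathbb{A}^\ell:\ t_i\ne0,1,\ t_i\ne t_j\ (i\neq j)\}.$$ For the complement $M=\mathbb{A}^\ell_k\backslash\bigcup_{i=1}^NH_i$ of an affine hyperplane arrangement over a field $k$ of characteristic $0$, let $\alpha_i$ be a degree-one polynomial defining $H_i$, $\mathcal{O}_M=k[t_1,\ldots,t_\ell,\alpha_1^{-1},\ldots,\alpha_N^{-1}]$, $\omega_i=d\log\alpha_i$, and let $\Omega^j(\mathcal{O}_M)$ be the algebraic $j$-forms. Put $V_0=k$, $V_1=\bigoplus_ik\,\omega_i$, and for $m\ge2$ let $V_m$ be the space of elements $\sum_Ic_I[\omega_{i_1}|\cdots|\omega_{i_m}]\in V_1^{\otimes m}$ ($c_I\in k$) such that $\sum_Ic_I\,\omega_{i_1}\otimes\cdots\otimes(\omega_{i_j}\wedge\omega_{i_{j+1}})\otimes\cdots\otimes\omega_{i_m}=0$ for all $1\le j<m$. Then $B(M)=\mathcal{O}_M\otimes_k\bigoplus_{m\ge0}V_m$ and $\Omega^jB(M)=\Omega^j(\mathcal{O}_M)\otimes_k\bigoplus_{m\ge0}V_m$,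 with differential $d:\Omega^jB(M)\to\Omega^{j+1}B(M)$, $$d\sum_I\phi_I\otimes[\omega_{i_1}|\cdots|\omega_{i_m}]=\sum_Id\phi_I\otimes[\omega_{i_1}|\cdots|\omega_{i_m}]+\sum_I(-1)^{\deg\phi_I}\phi_I\wedge\omega_{i_1}\otimes[\omega_{i_2}|\cdots|\omega_{i_m}].$$ $H^i_{\mathrm{DR}}(B(M))$ is the $i$-th cohomology of this complex. *)

theory Defs
  imports
    Complex_Main
    "HOL-Library.Poly_Mapping"
    "HOL-Library.Function_Algebras"
    "HOL-Computational_Algebra.Fraction_Field"
    "HOL-Algebra.Elementary_Groups"
begin

section \<open>Polynomials and rational functions in the variables $t_0, t_1, \ldots$\<close>

type_synonym 'k mpoly = "(nat \<Rightarrow>\<^sub>0 nat) \<Rightarrow>\<^sub>0 'k"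
type_synonym 'k ratfun = "'k mpoly fract"

definition Const :: "'k::field_char_0 \<Rightarrow> 'k mpoly" where
  "Const c = Poly_Mapping.single 0 c"

definition Var :: "nat \<Rightarrow> 'k::field_char_0 mpoly" where
  "Var i = Poly_Mapping.single (Poly_Mapping.single i 1) 1"

abbreviation rat_of_poly :: "'k::field_char_0 mpoly \<Rightarrow> 'k ratfun" where
  "rat_of_poly p \<equiv> Fract p 1"

abbreviation rconst :: "'k::field_char_0 \<Rightarrow> 'k ratfun" where
  "rconst c \<equiv> rat_of_poly (Const c)"

definition pdiff :: "nat \<Rightarrow> 'k::field_char_0 mpoly \<Rightarrow> 'k mpoly" where
  "pdiff i p = (\<Sum>m\<in>Poly_Mapping.keys p.
     Poly_Mapping.single (m - Poly_Mapping.single i 1)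
       (of_nat (Poly_Mapping.lookup m i) * Poly_Mapping.lookup p m))"

lemma pdiff_superset:
  assumes "finite A" "Poly_Mapping.keys p \<subseteq> A"
  shows "pdiff i p = (\<Sum>m\<in>A. Poly_Mapping.single (m - Poly_Mapping.single i 1)
       (of_nat (Poly_Mapping.lookup m i) * Poly_Mapping.lookup p m))"
  unfolding pdiff_def using assms
  by (intro sum.mono_neutral_left) (auto simp: in_keys_iff)

lemma pdiff_add: "pdiff i (p + q) = pdiff i p + pdiff i q"
proof -
  let ?A = "Poly_Mapping.keys p \<union> Poly_Mapping.keys q"
  have k: "Poly_Mapping.keys (p + q) \<subseteq> ?A"
    by (rule Poly_Mapping.keys_add)
  show ?thesis
    using k by (simp add: pdiff_superset[of ?A] lookup_add algebra_simps sum.distrib single_add)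
qed

lemma pdiff_zero: "pdiff i 0 = 0"
  by (simp add: pdiff_def)

lemma pdiff_sum: "pdiff i (\<Sum>x\<in>A. f x) = (\<Sum>x\<in>A. pdiff i (f x))"
  by (induction A rule: infinite_finite_induct) (simp_all add: pdiff_add pdiff_zero)

lemma pdiff_single:
  "pdiff i (Poly_Mapping.single m c) =
     Poly_Mapping.single (m - Poly_Mapping.single i 1) (of_nat (Poly_Mapping.lookup m i) * c)"
  by (simp add: pdiff_superset[of "{m}"])

lemma sum_monomials:
  "(p :: 'a \<Rightarrow>\<^sub>0 'b::comm_monoid_add) =
     (\<Sum>m\<in>Poly_Mapping.keys p. Poly_Mapping.single m (Poly_Mapping.lookup p m))"
  by (rule poly_mapping_eqI)
     (simp add: lookup_sum lookup_single when_def in_keys_iff)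

lemma monomial_diff_add:
  fixes m m' :: "nat \<Rightarrow>\<^sub>0 nat"
  assumes "Poly_Mapping.lookup m i \<noteq> 0"
  shows "m - Poly_Mapping.single i 1 + m' = m + m' - Poly_Mapping.single i 1"
  using assms
  by (intro poly_mapping_eqI) (auto simp: lookup_add lookup_minus lookup_single when_def)

lemma pdiff_mult_single:
  "pdiff i (Poly_Mapping.single m a * Poly_Mapping.single m' b :: 'k::field_char_0 mpoly) =
     pdiff i (Poly_Mapping.single m a) * Poly_Mapping.single m' b +
     Poly_Mapping.single m a * pdiff i (Poly_Mapping.single m' b)"
proof -
  let ?s = "m + m' - Poly_Mapping.single i 1"
  have l: "pdiff i (Poly_Mapping.single m a) * Poly_Mapping.single m' b =
      Poly_Mapping.single ?s (of_nat (Poly_Mapping.lookup m i) * a * b)"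
    by (cases "Poly_Mapping.lookup m i = 0")
       (simp_all add: pdiff_single mult_single monomial_diff_add del: One_nat_def)
  have r: "Poly_Mapping.single m a * pdiff i (Poly_Mapping.single m' b) =
      Poly_Mapping.single ?s (of_nat (Poly_Mapping.lookup m' i) * a * b)"
    using monomial_diff_add[of m' i m]
    by (cases "Poly_Mapping.lookup m' i = 0")
       (simp_all add: pdiff_single mult_single add.commute mult_ac del: One_nat_def)
  show ?thesis
    unfolding l r
    by (simp add: mult_single pdiff_single lookup_add algebra_simps flip: single_add)
qed

lemma pdiff_mult: "pdiff i (p * q) = pdiff i p * q + p * pdiff i q"
proof -
  let ?P = "\<lambda>m. Poly_Mapping.single m (Poly_Mapping.lookup p m)"
  let ?Q = "\<lambda>m. Poly_Mapping.single m (Poly_Mapping.lookup q m)"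
  have p: "p = sum ?P (Poly_Mapping.keys p)" and q: "q = sum ?Q (Poly_Mapping.keys q)"
    by (rule sum_monomials)+
  have "pdiff i (sum ?P A * sum ?Q B) =
      pdiff i (sum ?P A) * sum ?Q B + sum ?P A * pdiff i (sum ?Q B)" for A B
    unfolding sum_product pdiff_sum pdiff_mult_single sum.distrib ..
  from this[of "Poly_Mapping.keys p" "Poly_Mapping.keys q"] show ?thesis
    using p q by metis
qed

lift_definition rdiff :: "nat \<Rightarrow> 'k::field_char_0 ratfun \<Rightarrow> 'k ratfun" is
  "\<lambda>i q. (pdiff i (fst q) * snd q - fst q * pdiff i (snd q), snd q * snd q)"
proof -
  fix i :: nat and q r :: "'k mpoly \<times> 'k mpoly"
  assume "fractrel q r"
  then obtain a b c d where qr: "q = (a, b)" "r = (c, d)"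
    and nz: "b \<noteq> 0" "d \<noteq> 0" and eq: "a * d = c * b"
    by (cases q; cases r) auto
  have D: "pdiff i a * d + a * pdiff i d = pdiff i c * b + c * pdiff i b"
    using arg_cong[OF eq, of "pdiff i"] by (simp add: pdiff_mult)
  have "(pdiff i a * b - a * pdiff i b) * (d * d) - (pdiff i c * d - c * pdiff i d) * (b * b) =
      b * d * (pdiff i a * d + a * pdiff i d - (pdiff i c * b + c * pdiff i b))
      + (c * b - a * d) * (b * pdiff i d + d * pdiff i b)"
    by (simp add: algebra_simps)
  then have "(pdiff i a * b - a * pdiff i b) * (d * d) = (pdiff i c * d - c * pdiff i d) * (b * b)"
    by (simp add: D eq)
  then show "fractrel (pdiff i (fst q) * snd q - fst q * pdiff i (snd q), snd q * snd q)
      (pdiff i (fst r) * snd r - fst r * pdiff i (snd r), snd r * snd r)"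
    using nz by (simp add: qr)
qed

section \<open>Hyperplane arrangements and algebraic differential forms\<close>

text \<open>
  An arrangement of hyperplanes in affine space with coordinates \<open>t\<^sub>i\<close>, \<open>i < dim M\<close>; the
  hyperplane with index \<open>h \<in> hyps M\<close> is the zero locus of the degree-one polynomial \<open>lin M h\<close>.
  The index set is meant to be finite.
\<close>

record (overloaded) ('h, 'k) arrangement =
  dim :: nat
  hyps :: "'h set"
  lin :: "'h \<Rightarrow> 'k mpoly"

text \<open>The ring \<open>\<O>\<^sub>M\<close>, inside the field of rational functions.\<close>

inductive_set regular :: "('h, 'k::field_char_0) arrangement \<Rightarrow> 'k ratfun set"
  for M :: "('h, 'k) arrangement" where
  const: "rconst c \<in> regular M"
| var: "i < dim M \<Longrightarrow> rat_of_poly (Var i) \<in> regular M"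
| inv: "h \<in> hyps M \<Longrightarrow> inverse (rat_of_poly (lin M h)) \<in> regular M"
| add: "f \<in> regular M \<Longrightarrow> g \<in> regular M \<Longrightarrow> f + g \<in> regular M"
| mult: "f \<in> regular M \<Longrightarrow> g \<in> regular M \<Longrightarrow> f * g \<in> regular M"

text \<open>
  A differential form is given by its coefficients in the basis
  \<open>dt\<^sub>I = dt\<^sub>i\<^sub>1 \<and> \<dots> \<and> dt\<^sub>i\<^sub>j\<close> for \<open>I = {i\<^sub>1 < \<dots> < i\<^sub>j}\<close>.
\<close>

type_synonym 'k form = "nat set \<Rightarrow> 'k ratfun"

definition forms :: "('h, 'k::field_char_0) arrangement \<Rightarrow> nat \<Rightarrow> 'k form set" where
  "forms M j = {\<phi>. \<forall>I. \<phi> I \<in> regular M \<and> (\<phi> I \<noteq> 0 \<longrightarrow> I \<subseteq> {..<dim M} \<and> card I = j)}"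

definition fun_form :: "'k::field_char_0 ratfun \<Rightarrow> 'k form" where
  "fun_form f = (\<lambda>I. if I = {} then f else 0)"

definition scale :: "'k::field_char_0 ratfun \<Rightarrow> 'k form \<Rightarrow> 'k form" where
  "scale f \<phi> = (\<lambda>I. f * \<phi> I)"

text \<open>\<open>dt\<^sub>A \<and> dt\<^sub>B = shuffle_sign A B \<cdot> dt\<^sub>A\<^sub>\<union>\<^sub>B\<close> for disjoint finite \<open>A\<close>, \<open>B\<close>.\<close>

definition shuffle_sign :: "nat set \<Rightarrow> nat set \<Rightarrow> 'a::ring_1" where
  "shuffle_sign A B = (-1) ^ card {(a, b). a \<in> A \<and> b \<in> B \<and> b < a}"

definition wedge :: "'k::field_char_0 form \<Rightarrow> 'k form \<Rightarrow> 'k form" (infixl \<open>\<and>\<^sub>f\<close> 70) where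
  "\<phi> \<and>\<^sub>f \<psi> = (\<lambda>I. \<Sum>A\<in>Pow I. shuffle_sign A (I - A) * \<phi> A * \<psi> (I - A))"

definition ext_d :: "'k::field_char_0 form \<Rightarrow> 'k form" where
  "ext_d \<phi> = (\<lambda>I. \<Sum>i\<in>I. shuffle_sign {i} (I - {i}) * rdiff i (\<phi> (I - {i})))"

definition dlog :: "'k::field_char_0 ratfun \<Rightarrow> 'k form" where
  "dlog f = scale (inverse f) (ext_d (fun_form f))"

definition omega :: "('h, 'k::field_char_0) arrangement \<Rightarrow> 'h \<Rightarrow> 'k form" where
  "omega M h = dlog (rat_of_poly (lin M h))"

section \<open>The bar complex\<close>

text \<open>
  As \<open>V\<^sub>1\<close> has the basis \<open>\<omega>\<^sub>h\<close>, an element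
  \<open>\<Sum>\<^sub>I c\<^sub>I [\<omega>\<^sub>i\<^sub>1|\<dots>|\<omega>\<^sub>i\<^sub>m]\<close> of the \<open>m\<close>-th tensor power is given by its coefficients
  \<open>c\<close> on the words of length \<open>m\<close> in \<open>hyps M\<close>. The \<open>j\<close>-th integrability condition takes place in
  \<open>V\<^sub>1\<^sup>\<otimes>\<^sup>(\<^sup>j\<^sup>-\<^sup>1\<^sup>) \<otimes> \<Omega>\<^sup>2 \<otimes> V\<^sub>1\<^sup>\<otimes>\<^sup>(\<^sup>m\<^sup>-\<^sup>j\<^sup>-\<^sup>1\<^sup>)\<close>, and below it is read off on
  the basis elements \<open>u\<close> (of length \<open>j - 1\<close>) and \<open>v\<close> of the two outer factors.
  It is void for \<open>m < 2\<close>.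
\<close>

definition bar_words :: "('h, 'k::field_char_0) arrangement \<Rightarrow> nat \<Rightarrow> ('h list \<Rightarrow> 'k) set" where
  "bar_words M m = {c.
     (\<forall>w. c w \<noteq> 0 \<longrightarrow> length w = m \<and> set w \<subseteq> hyps M) \<and>
     (\<forall>u v. length u + 2 + length v = m \<longrightarrow>
        (\<Sum>a\<in>hyps M. \<Sum>b\<in>hyps M.
           scale (rconst (c (u @ [a, b] @ v))) (omega M a \<and>\<^sub>f omega M b)) = 0)}"

definition tens :: "'k::field_char_0 form \<Rightarrow> ('h list \<Rightarrow> 'k) \<Rightarrow> 'h list \<Rightarrow> 'k form" where
  "tens \<phi> c = (\<lambda>w. scale (rconst (c w)) \<phi>)"

text \<open>
  \<open>\<Omega>\<^sup>jB(M)\<close> as the span of the pure tensors inside \<open>\<Omega>\<^sup>j(\<O>\<^sub>M) \<otimes> T(V\<^sub>1)\<close>, whose elements are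
  families of \<open>j\<close>-forms indexed by words.
\<close>

definition bar_forms ::
    "('h, 'k::field_char_0) arrangement \<Rightarrow> nat \<Rightarrow> ('h list \<Rightarrow> 'k form) set" where
  "bar_forms M j = {\<Sum>r<N. tens (\<phi> r) (c r) | (N::nat) \<phi> c.
     \<forall>r<N. \<phi> r \<in> forms M j \<and> c r \<in> (\<Union>m. bar_words M m)}"

definition bar_d ::
    "('h, 'k::field_char_0) arrangement \<Rightarrow> nat \<Rightarrow> ('h list \<Rightarrow> 'k form) \<Rightarrow> 'h list \<Rightarrow> 'k form" where
  "bar_d M j \<Phi> = (\<lambda>w. ext_d (\<Phi> w) +
     (\<Sum>a\<in>hyps M. scale ((-1) ^ j) (\<Phi> (a # w) \<and>\<^sub>f omega M a)))"

definition cocycles ::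
    "('h, 'k::field_char_0) arrangement \<Rightarrow> nat \<Rightarrow> ('h list \<Rightarrow> 'k form) set" where
  "cocycles M i = {\<Phi> \<in> bar_forms M i. bar_d M i \<Phi> = 0}"

definition coboundaries ::
    "('h, 'k::field_char_0) arrangement \<Rightarrow> nat \<Rightarrow> ('h list \<Rightarrow> 'k form) set" where
  "coboundaries M i = (case i of 0 \<Rightarrow> {0} | Suc j \<Rightarrow> bar_d M j ` bar_forms M j)"

definition cocycle_group ::
    "('h, 'k::field_char_0) arrangement \<Rightarrow> nat \<Rightarrow> ('h list \<Rightarrow> 'k form) monoid" where
  "cocycle_group M i = \<lparr>carrier = cocycles M i, mult = (+), one = 0\<rparr>"

definition H_DR ::
    "('h, 'k::field_char_0) arrangement \<Rightarrow> nat \<Rightarrow> ('h list \<Rightarrow> 'k form) set monoid" where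
  "H_DR M i = cocycle_group M i Mod coboundaries M i"

section \<open>Moduli of genus zero curves\<close>

text \<open>Indices of the hyperplanes \<open>t\<^sub>i = 0\<close>, \<open>t\<^sub>i = 1\<close>, \<open>t\<^sub>i = t\<^sub>j\<close>.\<close>

datatype m0_hyp = At0 nat | At1 nat | Diag nat nat

fun m0_lin :: "m0_hyp \<Rightarrow> rat mpoly" where
  "m0_lin (At0 i) = Var i"
| "m0_lin (At1 i) = Var i - 1"
| "m0_lin (Diag i j) = Var i - Var j"

text \<open>
  In the coordinates that place three of the marked points at \<open>1, \<infinity>, 0\<close>; these are numbered
  \<open>t\<^sub>0, \<dots>, t\<^sub>\<ell>\<^sub>-\<^sub>1\<close> with \<open>\<ell> = card S - 3\<close>, so that only the number of labels matters.
\<close>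

definition M0 :: "'s set \<Rightarrow> (m0_hyp, rat) arrangement" where
  "M0 S = (let l = card S - 3 in
     \<lparr>dim = l,
      hyps = At0 ` {..<l} \<union> At1 ` {..<l} \<union> {Diag i j | i j. i < j \<and> j < l},
      lin = m0_lin\<rparr>)"

end

theory Submission
  imports Defs "HOL-Computational_Algebra.Polynomial"
begin

text \<open>
  Forms in \<open>B(M)\<close> are families \<open>\<Phi> I\<close> of \<open>\<O>\<^sub>M\<close>-valued functions on words, and the differential is the
  Koszul differential of the commuting operators \<open>\<nabla>\<^sub>i X w = \<partial>\<^sub>i (X w) + (\<Sum>\<^sub>a (\<partial>\<^sub>i \<alpha>\<^sub>a / \<alpha>\<^sub>a) X (a w))\<close>. Forgetting
  the last coordinate \<open>t\<^sub>m\<close> fibres the space over the one of dimension one less, the fibre being a line without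
  the points \<open>0, 1, t\<^sub>0, \<dots>, t\<^sub>m\<^sub>-\<^sub>1\<close>. Two facts about \<open>\<nabla>\<^sub>m\<close> suffice for an induction on the dimension: it is
  surjective, and its kernel is the space of families of the base. Both rest on partial fractions in \<open>t\<^sub>m\<close>;
  surjectivity also needs that a primitive of \<open>\<omega>\<^sub>f \<otimes> c\<close>, for a fibre letter \<open>f\<close> and an integrable word \<open>c\<close>, exists
  in the form of an integrable \<open>c'\<close> whose words that begin with a fibre letter are exactly those of \<open>f c\<close>.

  Integrability is used in the form of linear relations with rational coefficients (dual infinitesimal braid
  relations), so that it makes sense for \<open>\<O>\<^sub>M\<close>-valued functions on words and cuts out the tensor product.
\<close>

section \<open>Derivations of the field of rational functions\<close>

text \<open>The obstacle is to have enough integrable words. A simple pole has no primitive among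
  functions, so its integral must be found by adding a letter \<open>f\<close>; but prepending
  \<open>f\<close> to an integrable \<open>c\<close> in general violates the relations between
  \<open>f\<close> and the base letters. The correction consists of words that begin with a base
  letter. Their values in front of a fibre letter are forced by the relations and are data on
  shorter words, so they exist by induction on the length. The relations between two leading base
  letters leave no choice: they say that a curvature vanishes. This curvature is again an integrable
  family, hence determined by its values on words over the base and on words that begin with a fibre
  letter, and there it vanishes by Arnold's relation.

  Everything else in the surjectivity is integration by parts, which shortens words. Rational values
  are essential when integrability is turned into relations, because the logarithmic forms are
  linearly independent over the constants only; function coefficients are then handled through a
  basis of the rational span of the finitely many values.\<close>

instance fract :: ("{idom,ring_char_0}") ring_char_0
proof
  show "inj (of_nat :: nat \<Rightarrow> 'a fract)"
  proof (rule injI)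
    fix m n assume "(of_nat m :: 'a fract) = of_nat n"
    then have "Fract (of_nat m :: 'a) 1 = Fract (of_nat n) 1" by (simp only: Fract_of_nat_eq)
    then show "m = n" by (simp only: eq_fract one_neq_zero simp_thms not_False_eq_True mult_1_right of_nat_eq_iff)
  qed
qed

text \<open>Required by the locale \<open>derivation\<close>: only in characteristic zero is a
  polynomial with zero derivative constant.\<close>

instance fract :: ("{idom,ring_char_0}") field_char_0 ..

lemma rdiff_Fract:
  "b \<noteq> 0 \<Longrightarrow> rdiff i (Fract a b) = Fract (pdiff i a * b - a * pdiff i b) (b * b)"
  by transfer' auto

lemma pdiff_one [simp]: "pdiff i 1 = 0"
  using pdiff_single[of i 0 1] by simp

lemma rdiff_rat_of_poly: "rdiff i (rat_of_poly p) = rat_of_poly (pdiff i p)"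
  by (simp add: rdiff_Fract)

lemma pdiff_Const [simp]: "pdiff i (Const c) = 0"
  by (simp add: Const_def pdiff_single)

lemma pdiff_Var: "pdiff i (Var j) = (if i = j then 1 else 0)"
  by (simp add: Var_def pdiff_single lookup_single when_def)

lemma rdiff_add: "rdiff i (f + g) = rdiff i f + rdiff i g"
  by (cases f; cases g) (auto simp: rdiff_Fract eq_fract pdiff_add pdiff_mult algebra_simps)

lemma rdiff_mult: "rdiff i (f * g) = rdiff i f * g + f * rdiff i g"
  by (cases f; cases g) (auto simp: rdiff_Fract eq_fract pdiff_add pdiff_mult algebra_simps)

lemma rdiff_rconst [simp]: "rdiff i (rconst c) = 0"
  by (simp add: rdiff_rat_of_poly fract_collapse)

lemma rdiff_Var: "rdiff i (rat_of_poly (Var j)) = (if i = j then 1 else 0)"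
  by (simp add: rdiff_rat_of_poly pdiff_Var fract_collapse)

lemma pdiff_commute: "pdiff i (pdiff k p) = pdiff k (pdiff i p)"
proof -
  have *: "pdiff i (pdiff k (Poly_Mapping.single m c)) = pdiff k (pdiff i (Poly_Mapping.single m c))" for m c
  proof (cases "i = k")
    case False
    have "m - Poly_Mapping.single k 1 - Poly_Mapping.single i 1 = m - Poly_Mapping.single i 1 - Poly_Mapping.single k (1::nat)"
      by (intro poly_mapping_eqI) (auto simp: lookup_minus)
    then show ?thesis using False
      by (simp add: pdiff_single lookup_minus lookup_single when_def mult_ac)
  qed simp
  show ?thesis
    by (subst (1 2) sum_monomials[of p]) (simp add: pdiff_sum *)
qed

lemma rat_of_poly_diff: "rat_of_poly (p - q) = rat_of_poly p - rat_of_poly q"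
  by simp

lemma rconst_0 [simp]: "rconst 0 = 0" and rconst_1 [simp]: "rconst 1 = 1"
  by (simp_all add: Const_def fract_collapse)

lemma rconst_add: "rconst (a + b) = rconst a + rconst b"
  and rconst_mult: "rconst (a * b) = rconst a * rconst b"
  by (simp_all add: Const_def single_add mult_single)

lemma rconst_eq_iff [simp]: "rconst a = rconst b \<longleftrightarrow> a = b"
  by (simp add: eq_fract Const_def)
     (metis lookup_single_eq)

lemma rconst_uminus: "rconst (- a) = - rconst a"
  by (simp add: Const_def single_uminus)

section \<open>Derivations of a field and partial fractions over the constants\<close>

locale derivation =
  fixes D :: "'a::field_char_0 \<Rightarrow> 'a"
  assumes add: "D (f + g) = D f + D g"
    and mult: "D (f * g) = D f * g + f * D g"
begin

lemma zero [simp]: "D 0 = 0"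
  using add[of 0 0] by simp

lemma one [simp]: "D 1 = 0"
  using mult[of 1 1] by simp

lemma uminus: "D (- f) = - D f"
  using add[of f "- f"] by (simp add: eq_neg_iff_add_eq_0 add.commute)

lemma diff: "D (f - g) = D f - D g"
  using add[of f "- g"] by (simp add: uminus)

lemma sum: "D (\<Sum>x\<in>A. f x) = (\<Sum>x\<in>A. D (f x))"
  by (induction A rule: infinite_finite_induct) (simp_all add: add)

lemma power_Suc: "D (f ^ Suc n) = of_nat (Suc n) * f ^ n * D f"
  by (induction n) (simp_all add: mult algebra_simps)

lemma inverse: "D (inverse f) = - D f * inverse f ^ 2"
proof (cases "f = 0")
  case False
  have "D (f * inverse f) = 0" using False by simp
  then have "f * D (inverse f) = - D f * inverse f" unfolding mult by (simp add: add_eq_0_iff)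
  then show ?thesis using False by (simp add: field_simps power2_eq_square)
qed simp

lemma divide: "D (f / g) = D f / g - f * D g / g ^ 2"
  by (simp add: divide_inverse mult inverse power_inverse)

lemma of_nat: "D (of_nat n) = 0"
  by (induction n) (simp_all add: add)

text \<open>These are the polynomials over the field of constants of \<open>D\<close>; a predicate
  spares a separate type for that field.\<close>

definition const_poly :: "'a poly \<Rightarrow> bool" where
  "const_poly p \<longleftrightarrow> (\<forall>k. D (coeff p k) = 0)"

lemma const_poly_0 [intro!]: "const_poly 0"
  by (simp add: const_poly_def)

lemma const_poly_1 [intro!]: "const_poly 1"
  by (auto simp: const_poly_def coeff_1)

lemma const_poly_add [intro]: "const_poly p \<Longrightarrow> const_poly q \<Longrightarrow> const_poly (p + q)"
  by (simp add: const_poly_def add)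

lemma const_poly_mult [intro]: "const_poly p \<Longrightarrow> const_poly q \<Longrightarrow> const_poly (p * q)"
  by (simp add: const_poly_def coeff_mult sum mult)

lemma const_poly_sum [intro]: "(\<And>x. x \<in> A \<Longrightarrow> const_poly (f x)) \<Longrightarrow> const_poly (\<Sum>x\<in>A. f x)"
  by (induction A rule: infinite_finite_induct) auto

lemma const_poly_prod [intro]: "(\<And>x. x \<in> A \<Longrightarrow> const_poly (f x)) \<Longrightarrow> const_poly (\<Prod>x\<in>A. f x)"
  by (induction A rule: infinite_finite_induct)
     auto

lemma const_poly_power [intro]: "const_poly p \<Longrightarrow> const_poly (p ^ n)"
  by (induction n) auto

lemma const_poly_pCons [intro]: "D a = 0 \<Longrightarrow> const_poly p \<Longrightarrow> const_poly (pCons a p)"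
  by (auto simp: const_poly_def coeff_pCons split: nat.splits)

lemma const_poly_pderiv [intro]: "const_poly p \<Longrightarrow> const_poly (pderiv p)"
  by (simp add: const_poly_def coeff_pderiv mult add of_nat)

lemma const_poly_pCons_iff: "const_poly (pCons a p) \<longleftrightarrow> D a = 0 \<and> const_poly p"
  unfolding const_poly_def by (metis coeff_pCons_0 coeff_pCons_Suc not0_implies_Suc)

lemma D_poly: "const_poly p \<Longrightarrow> D (poly p f) = poly (pderiv p) f * D f"
  by (induction p) (auto simp: const_poly_pCons_iff add mult pderiv_pCons algebra_simps)

text \<open>By the chain rule a zero of \<open>p\<close> at \<open>t\<close> is a zero of the
  derivative, which vanishes by induction on the degree. So \<open>p\<close> is a constant, equal to
  its value 0 at \<open>t\<close>.\<close>

lemma transcendental: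
  assumes "D t = 1" "const_poly p" "poly p t = 0"
  shows "p = 0"
  using assms(2,3)
proof (induction "degree p" arbitrary: p rule: less_induct)
  case less
  have "pderiv p = 0"
  proof (cases "degree p = 0")
    case False
    have "poly (pderiv p) t = 0" using D_poly[OF less.prems(1), of t] less.prems(2) assms(1) by simp
    then show ?thesis using less.hyps[of "pderiv p"] less.prems(1) False
      by (auto simp: degree_pderiv)
  qed (auto simp: pderiv_eq_0_iff)
  then obtain a where "p = [:a:]" using pderiv_iszero by blast
  then show ?case using less.prems(2) by simp
qed

text \<open>At \<open>s\<close> only the summand of \<open>R\<close> with exponent
  \<open>n - k = 0\<close> survives. For \<open>n = degree B\<close> the value there is the leading
  coefficient, which is what detects the pole.\<close>

lemma clear_pole:
  assumes "D s = 0" "const_poly B" "t \<noteq> s" "degree B \<le> n"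
  shows "\<exists>R. const_poly R \<and> (t - s) ^ n * poly B (inverse (t - s)) = poly R t \<and>
     (n = degree B \<longrightarrow> poly R s = lead_coeff B)"
proof -
  define R where "R = (\<Sum>k\<le>n. [:coeff B k:] * [:- s, 1:] ^ (n - k))"
  have "(t - s) ^ n * poly B (inverse (t - s)) = (\<Sum>k\<le>n. coeff B k * (t - s) ^ (n - k))"
    unfolding poly_altdef sum_distrib_left
  proof (rule sum.mono_neutral_cong_left)
    fix k assume "k \<in> {..degree B}"
    then have "(t - s) ^ n = (t - s) ^ (n - k) * (t - s) ^ k" using assms(4)
      by (simp flip: power_add)
    then show "(t - s) ^ n * (coeff B k * inverse (t - s) ^ k) = coeff B k * (t - s) ^ (n - k)"
      using assms(3) by (simp add: field_simps power_inverse)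
  qed (use assms(4) in \<open>auto simp: coeff_eq_0\<close>)
  also have "\<dots> = poly R t" by (simp add: R_def poly_sum)
  finally have 1: "(t - s) ^ n * poly B (inverse (t - s)) = poly R t" .
  have 2: "poly R s = lead_coeff B" if "n = degree B"
  proof -
    have "poly R s = (\<Sum>k\<le>n. if k = n then coeff B n else 0)"
      unfolding R_def poly_sum by (intro sum.cong) (auto simp: power_0_left)
    then show ?thesis using that by simp
  qed
  have "const_poly R" unfolding R_def
    using assms(1,2) by (intro const_poly_sum const_poly_mult const_poly_power const_poly_pCons)
      (auto simp: const_poly_def[of B] uminus)
  then show ?thesis using 1 2 by blast
qed

text \<open>With denominators cleared, the relation becomes a polynomial that vanishes at the
  transcendental element \<open>t\<close> and hence is zero. Its value at \<open>s z\<close> is the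
  leading coefficient of the pole at \<open>s z\<close> times a nonzero product.\<close>

lemma partial_fractions_unique:
  assumes t: "D t = 1" and X: "finite X" and s: "\<And>x. x \<in> X \<Longrightarrow> D (s x) = 0" "inj_on s X"
    and P: "const_poly P" and B: "\<And>x. x \<in> X \<Longrightarrow> const_poly (B x)" "\<And>x. x \<in> X \<Longrightarrow> coeff (B x) 0 = 0"
    and 0: "poly P t + (\<Sum>x\<in>X. poly (B x) (inverse (t - s x))) = 0"
  shows "P = 0 \<and> (\<forall>x\<in>X. B x = 0)"
proof -
  have ts: "t \<noteq> s x" if "x \<in> X" for x using t s(1)[OF that] by auto
  have Bz: "B z = 0" if z: "z \<in> X" for z
  proof (rule ccontr)
    assume nz: "B z \<noteq> 0"
    let ?d = "degree (B z)"
    \<comment> \<open>Without a constant term a nonzero \<open>B z\<close> is a genuine pole. The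
      positive exponent makes \<open>L z ^ ?d\<close>, hence all terms of \<open>T\<close> but the
      first, vanish at \<open>s z\<close>.\<close>
    have d: "?d > 0" using B(2)[OF z] nz
      by (metis bot_nat_0.not_eq_extremum leading_coeff_0_iff)
    obtain R where R: "const_poly R" "(t - s z) ^ ?d * poly (B z) (inverse (t - s z)) = poly R t"
      "poly R (s z) = lead_coeff (B z)"
      using clear_pole[OF s(1)[OF z] B(1)[OF z] ts[OF z], of ?d] by auto
    have "\<exists>R. const_poly R \<and> (t - s x) ^ degree (B x) * poly (B x) (inverse (t - s x)) = poly R t"
      if "x \<in> X" for x using clear_pole[OF s(1)[OF that] B(1)[OF that] ts[OF that], of "degree (B x)"] by auto
    then obtain S where S: "\<And>x. x \<in> X \<Longrightarrow> const_poly (S x)"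
      "\<And>x. x \<in> X \<Longrightarrow> (t - s x) ^ degree (B x) * poly (B x) (inverse (t - s x)) = poly (S x) t"
      by metis
    define Y where "Y = X - {z}"
    define L where "L x = [:- s x, 1:]" for x
    define Q where "Q = (\<Prod>x\<in>Y. L x ^ degree (B x))"
    define Qx where "Qx x = (\<Prod>y\<in>Y - {x}. L y ^ degree (B y))" for x
    have Yf: "finite Y" and YX: "Y \<subseteq> X" using X by (auto simp: Y_def)
    have Lc: "const_poly (L x)" if "x \<in> X" for x
      unfolding L_def using s(1)[OF that] by (intro const_poly_pCons const_poly_0) (auto simp: uminus)
    have Q: "Q = L x ^ degree (B x) * Qx x" if "x \<in> Y" for x
      unfolding Q_def Qx_def using Yf that by (simp add: prod.remove)
    define T where "T = R * Q + L z ^ ?d * (Q * P + (\<Sum>x\<in>Y. Qx x * S x))"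
    have Tc: "const_poly T"
      unfolding T_def Q_def Qx_def using Lc z YX R(1) S(1) P
      by (intro const_poly_add const_poly_mult const_poly_sum const_poly_prod const_poly_power) auto
    have [simp]: "poly (L x) t = t - s x" for x by (simp add: L_def)
    have QS: "poly (Qx x * S x) t = poly Q t * poly (B x) (inverse (t - s x))" if "x \<in> Y" for x
      unfolding Q[OF that] using S(2)[of x] that YX by auto
    have "poly T t = poly Q t * (t - s z) ^ ?d * (poly P t + (poly (B z) (inverse (t - s z)) +
        (\<Sum>x\<in>Y. poly (B x) (inverse (t - s x)))))"
      unfolding T_def poly_add poly_mult poly_sum QS[unfolded poly_mult] R(2)[symmetric]
      using QS by (simp add: algebra_simps sum_distrib_left)
    also have "\<dots> = 0" using 0 sum.remove[OF X z, of "\<lambda>x. poly (B x) (inverse (t - s x))"] by (simp add: Y_def)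
    finally have "T = 0" using transcendental[OF t Tc] by blast
    then have "poly T (s z) = 0" by simp
    then have "lead_coeff (B z) * poly Q (s z) = 0"
      unfolding T_def using d by (simp add: R(3) L_def power_0_left)
    moreover have "poly Q (s z) \<noteq> 0"
      unfolding Q_def L_def poly_prod using Yf s(2) z by (auto simp: Y_def inj_on_def)
    ultimately show False using nz by simp
  qed
  then have "poly P t = 0" using 0 by simp
  then show ?thesis using transcendental[OF t P] Bz by blast
qed

end

interpretation rdiff: derivation "rdiff i" for i
  by unfold_locales (auto simp: rdiff_add rdiff_mult)

text \<open>A commutator of derivations is a derivation. This one kills polynomials, and applied to
  \<open>f * b = a\<close> it kills the quotient \<open>f\<close> too.\<close>

lemma rdiff_commute: "rdiff i (rdiff k f) = rdiff k (rdiff i f)"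
proof -
  define C where "C f = rdiff i (rdiff k f) - rdiff k (rdiff i f)" for f :: "'a ratfun"
  have C: "C (f * g) = C f * g + f * C g" for f g
    unfolding C_def by (simp add: rdiff_mult rdiff_add algebra_simps)
  have C0: "C (rat_of_poly p) = 0" for p by (simp add: C_def rdiff_rat_of_poly pdiff_commute)
  obtain a b where f: "f = Fract a b" "b \<noteq> 0" by (cases f) auto
  have "f * rat_of_poly b = rat_of_poly a" using f by (simp add: eq_fract)
  then have "C f * rat_of_poly b = 0" using C[of f "rat_of_poly b"] C0 by simp
  moreover have "rat_of_poly b \<noteq> 0" using f(2) by (simp add: Zero_fract_def eq_fract)
  ultimately show ?thesis by (simp add: C_def)
qed

section \<open>The fibration of configuration spaces\<close>

text \<open>The arrangement \<open>M0\<close> in terms of the dimension alone, on which the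
  induction runs.\<close>

definition conf :: "nat \<Rightarrow> (m0_hyp, rat) arrangement" where
  "conf l = \<lparr>dim = l, hyps = At0 ` {..<l} \<union> At1 ` {..<l} \<union> {Diag i j | i j. i < j \<and> j < l}, lin = m0_lin\<rparr>"

lemma M0_eq_conf: "M0 S = conf (card S - 3)"
  by (simp add: M0_def conf_def Let_def)

definition tv :: "nat \<Rightarrow> rat ratfun" where
  "tv i = rat_of_poly (Var i)"

lemma rdiff_tv: "rdiff i (tv j) = (if i = j then 1 else 0)"
  by (simp add: tv_def rdiff_Var)

text \<open>The finite marked points are numbered \<open>0, 1, 2, \<dots>\<close> with coordinates \<open>0, 1, t\<^sub>0, t\<^sub>1, \<dots>\<close>;
  \<open>fib m x\<close> is the hyperplane on which \<open>t\<^sub>m\<close> meets point \<open>x\<close>.\<close>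

fun pt :: "nat \<Rightarrow> rat ratfun" where
  "pt 0 = 0"
| "pt (Suc 0) = 1"
| "pt (Suc (Suc i)) = tv i"

fun fib :: "nat \<Rightarrow> nat \<Rightarrow> m0_hyp" where
  "fib m 0 = At0 m"
| "fib m (Suc 0) = At1 m"
| "fib m (Suc (Suc i)) = Diag i m"

fun ends :: "m0_hyp \<Rightarrow> nat set" where
  "ends (At0 i) = {0, i + 2}"
| "ends (At1 i) = {1, i + 2}"
| "ends (Diag i j) = {i + 2, j + 2}"

definition letters :: "nat \<Rightarrow> m0_hyp set" where
  "letters l = hyps (conf l)"

definition dlog_coeff :: "m0_hyp \<Rightarrow> nat \<Rightarrow> rat ratfun" where
  "dlog_coeff a i = rdiff i (rat_of_poly (m0_lin a)) / rat_of_poly (m0_lin a)"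

text \<open>A version of \<open>dlog_coeff\<close> for arbitrary pairs of points, also those without
  a letter. Division by zero makes it 0 for \<open>x = y\<close>, so sums may run over all points of
  the fibre.\<close>

definition pt_dlog :: "nat \<Rightarrow> nat \<Rightarrow> nat \<Rightarrow> rat ratfun" where
  "pt_dlog x y i = rdiff i (pt x - pt y) / (pt x - pt y)"

abbreviation O_ring :: "nat \<Rightarrow> rat ratfun set" where
  "O_ring l \<equiv> regular (conf l)"

lemma dim_conf [simp]: "dim (conf l) = l" and lin_conf [simp]: "lin (conf l) = m0_lin"
  by (simp_all add: conf_def)

lemma pt_conv_tv: "2 \<le> x \<Longrightarrow> pt x = tv (x - 2)"
  by (cases x rule: pt.cases) auto

lemma rdiff_pt: "rdiff i (pt x) = (if x = i + 2 then 1 else 0)"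
  by (cases x rule: pt.cases) (auto simp: rdiff_tv)

lemma pt_eq_iff: "pt x = pt y \<longleftrightarrow> x = y"
proof
  assume eq: "pt x = pt y"
  show "x = y"
  proof (cases "x < 2 \<and> y < 2")
    case True
    then show ?thesis using eq by (auto simp: numeral_2_eq_2 less_Suc_eq)
  next
    case False
    then obtain i where "x = i + 2 \<or> y = i + 2" by (metis add.commute le_Suc_ex linorder_not_less)
    then show ?thesis using arg_cong[OF eq, of "rdiff i"] by (auto simp: rdiff_pt split: if_splits)
  qed
qed simp

lemma fib_eq_iff: "fib m x = fib n y \<longleftrightarrow> m = n \<and> x = y"
  by (cases x rule: pt.cases; cases y rule: pt.cases) auto

lemma letters_0 [simp]: "letters 0 = {}"
  by (simp add: letters_def conf_def)

lemma letters_Suc: "letters (Suc m) = letters m \<union> fib m ` {..<m + 2}"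
proof -
  have "fib m ` {..<m + 2} = {At0 m, At1 m} \<union> (\<lambda>i. Diag i m) ` {..<m}"
    by (simp add: lessThan_Suc_eq_insert_0 image_insert image_image)
  then show ?thesis by (auto simp: letters_def conf_def less_Suc_eq)
qed

lemma fib_notin_H: "m \<le> n \<Longrightarrow> fib n x \<notin> letters m"
  by (cases x rule: pt.cases) (auto simp: letters_def conf_def)

lemma fib_in_H: "fib n x \<in> letters m \<longleftrightarrow> n < m \<and> x < n + 2"
  by (cases x rule: pt.cases) (auto simp: letters_def conf_def)

lemma finite_H [simp]: "finite (letters l)"
  by (induction l) (auto simp: letters_Suc)

lemma letters_mono: "m \<le> n \<Longrightarrow> letters m \<subseteq> letters n"
  by (auto simp: letters_def conf_def)

lemma sum_H_Suc: "(\<Sum>a\<in>letters (Suc m). f a) = (\<Sum>a\<in>letters m. f a) + (\<Sum>x<m + 2. f (fib m x))"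
proof -
  have "(\<Sum>a\<in>letters (Suc m). f a) = (\<Sum>a\<in>letters m. f a) + (\<Sum>a\<in>fib m ` {..<m + 2}. f a)"
    unfolding letters_Suc by (rule sum.union_disjoint) (use fib_notin_H in auto)
  also have "(\<Sum>a\<in>fib m ` {..<m + 2}. f a) = (\<Sum>x<m + 2. f (fib m x))"
    by (subst sum.reindex) (auto simp: inj_on_def fib_eq_iff)
  finally show ?thesis .
qed

lemma ends_fib: "ends (fib m x) = {x, m + 2}"
  by (cases x rule: pt.cases) auto

lemma letters_cases:
  assumes "a \<in> letters m"
  obtains n x where "n < m" "x < n + 2" "a = fib n x"
proof -
  have "\<exists>n x. n < m \<and> x < n + 2 \<and> a = fib n x"
    using assms by (induction m) (use less_Suc_eq in \<open>auto simp only: letters_Suc letters_0 Un_iff image_iff lessThan_iff empty_iff\<close>)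
  then show thesis using that by blast
qed

text \<open>The second sign occurs for \<open>Diag i m\<close>, whose polynomial is
  \<open>t\<^sub>i - t\<^sub>m\<close>; a logarithmic derivative does not see it.\<close>

lemma lin_fib: "rat_of_poly (m0_lin (fib m x)) = tv m - pt x \<or> rat_of_poly (m0_lin (fib m x)) = - (tv m - pt x)"
  by (cases x rule: pt.cases) (simp_all only: fib.simps m0_lin.simps pt.simps tv_def rat_of_poly_diff fract_collapse
    diff_zero minus_diff_eq simp_thms)

lemma dlog_coeff_fib: "dlog_coeff (fib m x) i = rdiff i (tv m - pt x) / (tv m - pt x)"
  using lin_fib[of m x] unfolding dlog_coeff_def by (elim disjE) (simp_all only: rdiff.uminus minus_divide_divide)

lemma tv_eq_pt_iff: "tv m = pt x \<longleftrightarrow> x = m + 2"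
  using pt_eq_iff[of "m + 2" x] by auto

lemma dlog_coeff_fib': "dlog_coeff (fib m x) i = pt_dlog (m + 2) x i"
  by (simp add: dlog_coeff_fib pt_dlog_def)

lemma pt_dlog_commute: "pt_dlog x y i = pt_dlog y x i"
  unfolding pt_dlog_def by (metis minus_diff_eq minus_divide_divide rdiff.uminus)

lemma pt_dlog_refl [simp]: "pt_dlog x x i = 0"
  by (simp add: pt_dlog_def)

lemma pt_dlog_01: "pt_dlog 0 1 i = 0"
  by (simp add: pt_dlog_def rdiff_pt rdiff.uminus)

text \<open>Letters are determined by the pair of points that collide; the pair of the fixed points
  \<open>0\<close>, \<open>1\<close> has no letter, consistently with \<open>pt_dlog 0 1\<close> being zero.\<close>

lemma letter_of_ends:
  assumes "a \<in> letters m" "ends a = {x, y}"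
  shows "x \<noteq> y" "max x y \<ge> 2" "a = fib (max x y - 2) (min x y)"
  using assms by (elim letters_cases; force simp: ends_fib doubleton_eq_iff max_def min_def)+

lemma pt_dlog_conv_letters:
  assumes "x < m + 2" "y < m + 2"
  shows "pt_dlog x y i = (\<Sum>a\<in>letters m. if ends a = {x, y} then dlog_coeff a i else 0)"
proof (cases "x \<noteq> y \<and> max x y \<ge> 2")
  case True
  define b where "b = fib (max x y - 2) (min x y)"
  have b: "b \<in> letters m" "ends b = {x, y}"
    using True assms unfolding b_def fib_in_H ends_fib by (auto simp: max_def min_def)
  have "ends a = {x, y} \<longleftrightarrow> a = b" if "a \<in> letters m" for a
    using letter_of_ends(3)[OF that] b(2) unfolding b_def by blast
  then have "(\<Sum>a\<in>letters m. if ends a = {x, y} then dlog_coeff a i else 0) = (\<Sum>a\<in>letters m. if a = b then dlog_coeff b i else 0)"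
    by (intro sum.cong) simp_all
  also have "\<dots> = dlog_coeff b i" using b by simp
  also have "\<dots> = pt_dlog (max x y) (min x y) i"
  proof -
    have "max x y - 2 + 2 = max x y" using True le_add_diff_inverse2 by blast
    then show ?thesis unfolding b_def dlog_coeff_fib' by (simp only:)
  qed
  also have "\<dots> = pt_dlog x y i" using pt_dlog_commute[of x y i]
    by (auto simp: max_def min_def)
  finally show ?thesis ..
next
  case False
  then have "x = y \<or> x = 0 \<and> y = 1 \<or> x = 1 \<and> y = 0" by linarith
  then have "pt_dlog x y i = 0" using pt_dlog_01[of i] pt_dlog_commute[of 1 0 i] by auto
  moreover have "(\<Sum>a\<in>letters m. if ends a = {x, y} then dlog_coeff a i else 0) = 0"
    using letter_of_ends[of _ m x y] False by (intro sum.neutral) auto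
  ultimately show ?thesis by simp
qed

text \<open>Arnold's relation in coordinates, with \<open>a1\<close>, \<open>a2\<close> and
  \<open>b1\<close>, \<open>b2\<close> in the role of partial derivatives of \<open>a\<close> and
  \<open>b\<close>. It rests on 1/(ab) = (1/b - 1/a)/(a - b).\<close>

lemma arnold:
  fixes a b :: "'a::field"
  assumes "a \<noteq> 0" "b \<noteq> 0" "a \<noteq> b"
  shows "(a1 / a) * (b2 / b) - (a2 / a) * (b1 / b) =
    ((a1 - b1) / (a - b)) * (b2 / b - a2 / a) - ((a2 - b2) / (a - b)) * (b1 / b - a1 / a)"
proof -
  have "a - b \<noteq> 0" using assms by simp
  then show ?thesis using assms by (simp add: divide_simps) (simp add: algebra_simps)
qed

text \<open>Here \<open>a = pt x - pt z\<close> and \<open>b = pt y - pt z\<close>, so that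
  \<open>a - b = pt x - pt y\<close>. When points coincide, the symmetry of \<open>pt_dlog\<close>
  and its value 0 on the diagonal suffice.\<close>

lemma arnold_pq:
  "pt_dlog x z i * pt_dlog y z k - pt_dlog x z k * pt_dlog y z i =
    pt_dlog x y i * (pt_dlog y z k - pt_dlog x z k) - pt_dlog x y k * (pt_dlog y z i - pt_dlog x z i)"
proof (cases "x = y \<or> x = z \<or> y = z")
  case False
  have "pt_dlog x z i * pt_dlog y z k - pt_dlog x z k * pt_dlog y z i =
    ((rdiff i (pt x - pt z) - rdiff i (pt y - pt z)) / ((pt x - pt z) - (pt y - pt z))) * (pt_dlog y z k - pt_dlog x z k) -
    ((rdiff k (pt x - pt z) - rdiff k (pt y - pt z)) / ((pt x - pt z) - (pt y - pt z))) * (pt_dlog y z i - pt_dlog x z i)"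
    unfolding pt_dlog_def by (rule arnold) (use False in \<open>auto simp: pt_eq_iff\<close>)
  then show ?thesis by (simp add: rdiff.diff pt_dlog_def)
qed (auto simp: pt_dlog_commute)

text \<open>Closedness of the logarithmic form: mixed second derivatives agree, and the quadratic
  term is symmetric.\<close>

lemma rdiff_q_commute: "rdiff i (dlog_coeff a k) = rdiff k (dlog_coeff a i)"
  unfolding dlog_coeff_def rdiff.divide by (simp add: rdiff_commute[of k i] mult.commute)

section \<open>The tower of coordinate rings\<close>

lemma O_mono: "m \<le> n \<Longrightarrow> f \<in> O_ring m \<Longrightarrow> f \<in> O_ring n"
proof -
  assume m: "m \<le> n" and "f \<in> O_ring m"
  from this(2) show ?thesis
    by induction (use m letters_mono[OF m] in \<open>auto intro: regular.intros regular.inv[of _ "conf n", simplified] simp: letters_def\<close>)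
qed

lemma O_0 [simp]: "0 \<in> O_ring m" and O_1 [simp]: "1 \<in> O_ring m"
  using regular.const[of 0 "conf m"] regular.const[of 1 "conf m"] by simp_all

lemma O_uminus: "f \<in> O_ring m \<Longrightarrow> - f \<in> O_ring m"
  using regular.mult[OF regular.const[of "- 1" "conf m"], of f] by (simp add: rconst_uminus)

lemma O_diff: "f \<in> O_ring m \<Longrightarrow> g \<in> O_ring m \<Longrightarrow> f - g \<in> O_ring m"
  using regular.add[of f "conf m" "- g"] O_uminus[of g m] by simp

lemma O_sum: "(\<And>x. x \<in> A \<Longrightarrow> f x \<in> O_ring m) \<Longrightarrow> (\<Sum>x\<in>A. f x) \<in> O_ring m"
  by (induction A rule: infinite_finite_induct) (auto intro: regular.add)

lemma O_power: "f \<in> O_ring m \<Longrightarrow> f ^ n \<in> O_ring m"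
  by (induction n) (auto intro: regular.mult)

lemma O_pt: "x < m + 2 \<Longrightarrow> pt x \<in> O_ring m"
  by (cases x rule: pt.cases) (auto simp: tv_def intro: regular.var)

lemma O_inverse_fib: "n < m \<Longrightarrow> x < n + 2 \<Longrightarrow> inverse (tv n - pt x) \<in> O_ring m"
  using regular.inv[of "fib n x" "conf m"] fib_in_H[of n x m] lin_fib[of n x]
  by (auto simp: letters_def simp del: inverse_fract dest: O_uminus)
     (metis O_uminus inverse_minus_eq minus_diff_eq)

text \<open>The positions of distinct poles along the fibre differ by units of the base ring, so
  products of poles split without new denominators. For \<open>x = y\<close> the inverse is
  0.\<close>

lemma O_inverse_pt:
  assumes "x < m + 2" "y < m + 2"
  shows "inverse (pt x - pt y) \<in> O_ring m"
proof -
  have *: "inverse (pt x - pt y) \<in> O_ring m" if "y < x" "x < m + 2" for x y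
  proof (cases "x \<ge> 2")
    case True
    then show ?thesis using O_inverse_fib[of "x - 2" m y] that by (simp add: pt_conv_tv)
  next
    case False
    then have "x = 1" "y = 0" using that by auto
    then show ?thesis by simp
  qed
  show ?thesis
    using *[of y x] *[of x y] assms O_uminus[of "inverse (pt y - pt x)" m]
    by (cases x y rule: linorder_cases) (auto simp flip: inverse_minus_eq)
qed

lemma dlog_coeff_in_O:
  assumes "a \<in> letters m"
  shows "dlog_coeff a i \<in> O_ring m"
proof -
  obtain n x where nx: "n < m" "x < n + 2" "a = fib n x" using assms by (rule letters_cases)
  have "dlog_coeff a i = rdiff i (tv n - pt x) * inverse (tv n - pt x)"
    by (simp add: nx(3) dlog_coeff_fib divide_inverse)
  then show ?thesis
    using O_inverse_fib[OF nx(1,2)]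
    by (auto intro!: regular.mult O_uminus O_diff simp: rdiff.diff rdiff_pt rdiff_tv)
qed

lemma rdiff_O: "f \<in> O_ring m \<Longrightarrow> rdiff i f \<in> O_ring m"
proof (induction rule: regular.induct)
  case (inv h)
  have "rdiff i (inverse (rat_of_poly (m0_lin h))) = - dlog_coeff h i * inverse (rat_of_poly (m0_lin h))"
    unfolding rdiff.inverse dlog_coeff_def divide_inverse power2_eq_square by (simp only: mult.assoc mult_minus_left)
  then show ?case using inv dlog_coeff_in_O[of h m i] regular.inv[OF inv]
    by (auto simp: letters_def simp del: inverse_fract intro!: regular.mult O_uminus)
qed (auto simp: rdiff_Var rdiff_mult rdiff_add intro: regular.intros)

lemma dlog_coeff_eq_0: "a \<in> letters m \<Longrightarrow> m \<le> i \<Longrightarrow> dlog_coeff a i = 0"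
  by (elim letters_cases) (auto simp: dlog_coeff_fib rdiff.diff rdiff_pt rdiff_tv)

lemma rdiff_O_eq_0: "f \<in> O_ring m \<Longrightarrow> m \<le> i \<Longrightarrow> rdiff i f = 0"
proof (induction rule: regular.induct)
  case (inv h)
  have "rdiff i (inverse (rat_of_poly (m0_lin h))) = - dlog_coeff h i * inverse (rat_of_poly (m0_lin h))"
    unfolding rdiff.inverse dlog_coeff_def divide_inverse power2_eq_square by (simp only: mult.assoc mult_minus_left)
  then show ?case using inv dlog_coeff_eq_0[of h m i] by (simp add: letters_def)
qed (auto simp: rdiff_Var rdiff_mult rdiff_add)

section \<open>Partial fractions along the fibre\<close>

inductive_set pfrac :: "nat \<Rightarrow> rat ratfun set" for m where
  poly: "a \<in> O_ring m \<Longrightarrow> a * tv m ^ k \<in> pfrac m"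
| pole: "a \<in> O_ring m \<Longrightarrow> x < m + 2 \<Longrightarrow> a * inverse (tv m - pt x) ^ Suc k \<in> pfrac m"
| add: "f \<in> pfrac m \<Longrightarrow> g \<in> pfrac m \<Longrightarrow> f + g \<in> pfrac m"

lemma tv_minus_pt_nonzero: "x < m + 2 \<Longrightarrow> tv m - pt x \<noteq> 0"
  by (simp add: tv_eq_pt_iff)

lemma pfrac_O: "a \<in> O_ring m \<Longrightarrow> a \<in> pfrac m"
  using pfrac.poly[of a m 0] by simp

lemma pfrac_scale: "f \<in> pfrac m \<Longrightarrow> a \<in> O_ring m \<Longrightarrow> a * f \<in> pfrac m"
proof (induction rule: pfrac.induct)
  case (poly b k)
  then show ?case using pfrac.poly[of "a * b" m k] by (simp add: mult.assoc regular.mult)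
next
  case (pole b x k)
  then show ?case using pfrac.pole[of "a * b" m x k] by (simp add: mult.assoc regular.mult)
qed (auto simp: distrib_left intro: pfrac.add)

lemma pfrac_pole0: "a \<in> O_ring m \<Longrightarrow> x < m + 2 \<Longrightarrow> a * inverse (tv m - pt x) ^ k \<in> pfrac m"
  by (cases k) (use pfrac_O pfrac.pole in auto)

lemma pfrac_tv: "f \<in> pfrac m \<Longrightarrow> f * tv m \<in> pfrac m"
proof (induction rule: pfrac.induct)
  case (poly a k)
  then show ?case using pfrac.poly[of a m "Suc k"] by (simp add: mult_ac)
next
  case (pole a x k)
  let ?u = "inverse (tv m - pt x)"
  have "?u * tv m = 1 + pt x * ?u" using tv_minus_pt_nonzero[OF pole(2)] by (simp add: field_simps)
  then have "a * ?u ^ Suc k * tv m = a * ?u ^ k * (1 + pt x * ?u)" by (simp add: mult_ac)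
  also have "\<dots> = a * ?u ^ k + (a * pt x) * ?u ^ Suc k" by (simp add: algebra_simps)
  also have "\<dots> \<in> pfrac m"
    using pole by (intro pfrac.add pfrac_pole0 pfrac.pole regular.mult O_pt)
  finally show ?case .
qed (auto simp: distrib_right intro: pfrac.add)

lemma pfrac_inverse:
  assumes "f \<in> pfrac m" and y: "y < m + 2"
  shows "f * inverse (tv m - pt y) \<in> pfrac m"
  using assms(1)
proof (induction rule: pfrac.induct)
  case (poly a k)
  let ?u = "inverse (tv m - pt y)"
  have u: "tv m * ?u = 1 + pt y * ?u" using tv_minus_pt_nonzero[OF y] by (simp add: field_simps)
  have "b * tv m ^ k * ?u \<in> pfrac m" if "b \<in> O_ring m" for b
    using that
  proof (induction k arbitrary: b)
    case 0
    then show ?case using pfrac.pole[of b m y 0] y by simp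
  next
    case (Suc k)
    have "b * tv m ^ Suc k * ?u = b * tv m ^ k * (tv m * ?u)" by (simp add: mult_ac)
    also have "\<dots> = b * tv m ^ k + (b * pt y) * tv m ^ k * ?u"
      unfolding u by (simp add: algebra_simps)
    also have "\<dots> \<in> pfrac m"
      using Suc.prems y by (intro pfrac.add Suc.IH pfrac.poly regular.mult O_pt)
    finally show ?case .
  qed
  then show ?case using poly by blast
next
  case (pole a x k)
  let ?u = "inverse (tv m - pt y)" and ?v = "inverse (tv m - pt x)"
  show ?case
  proof (cases "x = y")
    case True
    then show ?thesis using pfrac.pole[OF pole, of "Suc k"] by (simp add: mult_ac)
  next
    case False
    \<comment> \<open>Two distinct simple poles split with the constant \<open>w\<close>; each use
      of \<open>uv\<close> lowers the exponent of \<open>?v\<close> in the mixed term, down to a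
      simple pole at \<open>pt y\<close>.\<close>
    define w where "w = inverse (pt x - pt y)"
    have w: "w \<in> O_ring m" using O_inverse_pt[OF pole(2) y] by (simp add: w_def)
    have "pt x - pt y \<noteq> 0" using False by (simp add: pt_eq_iff)
    then have uv: "?v * ?u = w * ?v - w * ?u"
      unfolding w_def using tv_minus_pt_nonzero[OF y] tv_minus_pt_nonzero[OF pole(2)]
      by (simp add: divide_simps)
    have "b * ?v ^ k * ?u \<in> pfrac m" if "b \<in> O_ring m" for b k
      using that
    proof (induction k arbitrary: b)
      case 0
      then show ?case using pfrac.pole[of b m y 0] y by simp
    next
      case (Suc k)
      have "b * ?v ^ Suc k * ?u = b * ?v ^ k * (?v * ?u)" by (simp add: mult_ac)
      also have "\<dots> = (b * w) * ?v ^ Suc k + (- (b * w)) * ?v ^ k * ?u"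
        unfolding uv by (simp add: algebra_simps)
      also have "\<dots> \<in> pfrac m"
        using Suc.prems pole(2) w by (intro pfrac.add Suc.IH pfrac.pole regular.mult O_uminus)
      finally show ?case .
    qed
    then show ?thesis using pole by blast
  qed
qed (auto simp: distrib_right intro: pfrac.add)

text \<open>Strengthened to the claim that multiplication by \<open>f\<close> preserves
  \<open>pfrac m\<close>. Then only generators need a computation, products become compositions, and
  \<open>g = 1\<close> returns \<open>f\<close> itself.\<close>

lemma O_Suc_pfrac:
  assumes "f \<in> O_ring (Suc m)"
  shows "f \<in> pfrac m"
proof -
  have "\<forall>g\<in>pfrac m. g * f \<in> pfrac m"
    using assms
  proof (induction rule: regular.induct)
    case (const c)
    show ?case using pfrac_scale[OF _ regular.const[of c]] by (simp add: mult.commute)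
  next
    case (var i)
    show ?case
    proof (cases "i = m")
      case True
      then show ?thesis using pfrac_tv by (simp add: tv_def)
    next
      case False
      then show ?thesis using pfrac_scale regular.var[of i "conf m"] var by (simp add: mult.commute)
    qed
  next
    case (inv h)
    consider "h \<in> letters m" | x where "x < m + 2" "h = fib m x" using inv by (auto simp: letters_Suc simp flip: letters_def)
    then show ?case
    proof cases
      case 1
      then have "inverse (rat_of_poly (m0_lin h)) \<in> O_ring m" using regular.inv[of h "conf m"] by (simp add: letters_def)
      then show ?thesis using pfrac_scale by (simp add: mult.commute del: inverse_fract)
    next
      case 2
      have "- f \<in> pfrac m" if "f \<in> pfrac m" for f
        using pfrac_scale[OF that O_uminus[OF O_1]] by simp
      then show ?thesis using pfrac_inverse[of _ m x] lin_fib[of m x] 2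
        by (auto simp del: inverse_fract minus_diff_eq simp: inverse_minus_eq)
    qed
  next
    case (add f g)
    then show ?case by (auto simp: distrib_left intro: pfrac.add)
  next
    case (mult f g)
    then show ?case by (auto simp flip: mult.assoc)
  qed
  then show ?thesis using pfrac_O[OF O_1] by force
qed

lemma O_tv: "i < m \<Longrightarrow> tv i \<in> O_ring m"
  by (simp add: tv_def regular.var)

lemma O_inverse_tv: "x < m + 2 \<Longrightarrow> inverse (tv m - pt x) \<in> O_ring (Suc m)"
  by (simp add: O_inverse_fib)

lemma of_nat_eq_rconst: "(of_nat n :: 'k::field_char_0 ratfun) = rconst (of_nat n)"
  by (induction n) (simp_all only: of_nat_0 of_nat_Suc rconst_0 rconst_1 rconst_add)

lemma O_inverse_of_nat: "inverse (of_nat n) \<in> O_ring m"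
proof -
  have "inverse (of_nat n :: rat ratfun) = rconst (inverse (of_nat n))"
  proof (cases "n = 0")
    case False
    have "rconst (inverse (of_nat n) :: rat) * of_nat n = 1"
      unfolding of_nat_eq_rconst rconst_mult[symmetric] using False by simp
    then show ?thesis using False inverse_unique by (metis mult.commute)
  qed simp
  then show ?thesis using regular.const by metis
qed

text \<open>Partial fractions are integrated term by term, the base ring being constant for
  \<open>rdiff m\<close>. Only simple poles have no primitive; the \<open>A x\<close> are their
  residues.\<close>

lemma O_Suc_primitive:
  assumes "f \<in> O_ring (Suc m)"
  shows "\<exists>g A. g \<in> O_ring (Suc m) \<and> (\<forall>x. A x \<in> O_ring m) \<and>
     f = rdiff m g + (\<Sum>x<m + 2. A x * inverse (tv m - pt x))"
  using O_Suc_pfrac[OF assms]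
proof (induction rule: pfrac.induct)
  case (poly a k)
  define c where "c = (inverse (of_nat (Suc k)) :: rat ratfun)"
  have "c * of_nat (Suc k) = 1" unfolding c_def by (rule left_inverse) (simp del: of_nat_Suc)
  moreover have "rdiff m (a * c) = 0"
    unfolding c_def by (intro rdiff_O_eq_0[of _ m] regular.mult poly O_inverse_of_nat order.refl)
  then have "rdiff m (a * c * tv m ^ Suc k) = a * (c * of_nat (Suc k)) * tv m ^ k"
    unfolding rdiff.mult[of _ "a * c"] rdiff.power_Suc by (simp add: rdiff_tv mult_ac)
  moreover have "a * c * tv m ^ Suc k \<in> O_ring (Suc m)"
    using poly O_mono[of m "Suc m"] O_inverse_of_nat[of "Suc k" "Suc m"]
    by (auto simp: c_def simp del: power_Suc intro!: regular.mult O_power O_tv)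
  ultimately show ?case by (intro exI[of _ "a * c * tv m ^ Suc k"] exI[of _ "\<lambda>_. 0"]) simp
next
  case (pole a x k)
  let ?u = "inverse (tv m - pt x)"
  show ?case
  proof (cases k)
    case 0
    then show ?thesis using pole
      by (intro exI[of _ "0"] exI[of _ "\<lambda>y. if y = x then a else 0"])
         (simp add: if_distrib[of "\<lambda>z. z * _"] del: sum.lessThan_Suc cong: if_cong)
  next
    case (Suc j)
    define c where "c = - (inverse (of_nat (Suc j)) :: rat ratfun)"
    have c1: "c * of_nat (Suc j) = - 1" unfolding c_def mult_minus_left
      by (subst left_inverse) (simp_all del: of_nat_Suc)
    have "rdiff m (a * c) = 0"
      unfolding c_def by (intro rdiff_O_eq_0[of _ m] regular.mult pole O_uminus O_inverse_of_nat order.refl)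
    moreover have "rdiff m ?u = - (?u ^ 2)"
      using pole(2) by (simp add: rdiff.inverse rdiff.diff rdiff_pt rdiff_tv)
    ultimately have "rdiff m (a * c * ?u ^ Suc j) = a * (c * of_nat (Suc j)) * (?u ^ j * - (?u ^ 2))"
      unfolding rdiff.mult[of _ "a * c"] rdiff.power_Suc by (simp only: mult_zero_left add_0_left mult_ac)
    then have "rdiff m (a * c * ?u ^ Suc j) = a * ?u ^ Suc k"
      unfolding c1 Suc by (simp add: power2_eq_square mult_ac)
    moreover have "a * c * ?u ^ Suc j \<in> O_ring (Suc m)"
      using pole O_mono[of m "Suc m"] O_inverse_of_nat[of "Suc j" "Suc m"] O_inverse_tv[OF pole(2)]
      by (auto simp: c_def simp del: power_Suc intro!: regular.mult O_power O_uminus)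
    ultimately show ?thesis by (intro exI[of _ "a * c * ?u ^ Suc j"] exI[of _ "\<lambda>_. 0"]) simp
  qed
next
  case (add f1 f2)
  obtain g1 A1 where 1: "g1 \<in> O_ring (Suc m)" "\<forall>x. A1 x \<in> O_ring m"
    "f1 = rdiff m g1 + (\<Sum>x<m + 2. A1 x * inverse (tv m - pt x))" using add.IH(1) by blast
  obtain g2 A2 where 2: "g2 \<in> O_ring (Suc m)" "\<forall>x. A2 x \<in> O_ring m"
    "f2 = rdiff m g2 + (\<Sum>x<m + 2. A2 x * inverse (tv m - pt x))" using add.IH(2) by blast
  show ?case
    by (intro exI[of _ "g1 + g2"] exI[of _ "\<lambda>x. A1 x + A2 x"] conjI allI regular.add)
       (use 1 2 in \<open>simp_all only: rdiff_add distrib_right sum.distrib add_ac\<close>)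
qed

lemma pfrac_polys:
  assumes "f \<in> pfrac m"
  shows "\<exists>P B. (\<forall>k. coeff P k \<in> O_ring m) \<and> (\<forall>x k. coeff (B x) k \<in> O_ring m) \<and> (\<forall>x. coeff (B x) 0 = 0) \<and>
    f = poly P (tv m) + (\<Sum>x<m + 2. poly (B x) (inverse (tv m - pt x)))"
  using assms
proof (induction rule: pfrac.induct)
  case (poly a k)
  then show ?case
    by (intro exI[of _ "monom a k"] exI[of _ "\<lambda>_. 0"]) (auto simp: poly_monom)
next
  case (pole a x k)
  then show ?case
    by (intro exI[of _ 0] exI[of _ "\<lambda>y. if y = x then monom a (Suc k) else 0"])
       (auto simp: poly_monom if_distrib[of "\<lambda>p. poly p _"] simp del: sum.lessThan_Suc power_Suc cong: if_cong)
next
  case (add f1 f2)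
  obtain P1 B1 where 1: "\<forall>k. coeff P1 k \<in> O_ring m" "\<forall>x k. coeff (B1 x) k \<in> O_ring m" "\<forall>x. coeff (B1 x) 0 = 0"
    "f1 = poly P1 (tv m) + (\<Sum>x<m + 2. poly (B1 x) (inverse (tv m - pt x)))" using add.IH(1) by blast
  obtain P2 B2 where 2: "\<forall>k. coeff P2 k \<in> O_ring m" "\<forall>x k. coeff (B2 x) k \<in> O_ring m" "\<forall>x. coeff (B2 x) 0 = 0"
    "f2 = poly P2 (tv m) + (\<Sum>x<m + 2. poly (B2 x) (inverse (tv m - pt x)))" using add.IH(2) by blast
  show ?case
    by (intro exI[of _ "P1 + P2"] exI[of _ "\<lambda>x. B1 x + B2 x"] conjI allI)
       (use 1 2 in \<open>simp_all add: sum.distrib regular.add del: sum.lessThan_Suc\<close>)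
qed

text \<open>A derivative has no simple poles, so the residues \<open>A x\<close> vanish. Then the
  derivative of \<open>f\<close> is zero, and its partial fractions reduce to one constant from the
  base.\<close>

lemma O_Suc_closed:
  assumes f: "f \<in> O_ring (Suc m)" and A: "\<And>x. x < m + 2 \<Longrightarrow> rdiff m (A x) = 0"
    and 0: "rdiff m f + (\<Sum>x<m + 2. A x * inverse (tv m - pt x)) = 0"
  shows "f \<in> O_ring m" "\<And>x. x < m + 2 \<Longrightarrow> A x = 0"
proof -
  let ?u = "\<lambda>x. inverse (tv m - pt x)"
  obtain P B where P: "\<forall>k. coeff P k \<in> O_ring m" and B: "\<forall>x k. coeff (B x) k \<in> O_ring m" "\<forall>x. coeff (B x) 0 = 0"
    and f_eq: "f = poly P (tv m) + (\<Sum>x<m + 2. poly (B x) (?u x))"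
    using pfrac_polys[OF O_Suc_pfrac[OF f]] by blast
  have cP: "rdiff.const_poly m P" and cB: "rdiff.const_poly m (B x)" for x
    using P B(1) by (auto simp: rdiff.const_poly_def intro!: rdiff_O_eq_0)
  \<comment> \<open>In u = 1/(t - p) the derivative is du/dt = - u^2. So \<open>A x\<close> sits in
    degree 1, and the derivative of the polar part in degrees 2 and higher.\<close>
  define B' where "B' x = [:0, A x:] + [:0, 0, - 1:] * pderiv (B x)" for x
  have Du: "rdiff m (?u x) = - (?u x ^ 2)" if "x < m + 2" for x
    using that by (simp add: rdiff.inverse rdiff.diff rdiff_pt rdiff_tv)
  have "rdiff m f = poly (pderiv P) (tv m) + (\<Sum>x<m + 2. poly ([:0, 0, - 1:] * pderiv (B x)) (?u x))"
    unfolding f_eq rdiff.add rdiff.sum rdiff.D_poly[OF cP] rdiff.D_poly[OF cB]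
    by (intro arg_cong2[of _ _ _ _ "(+)"] sum.cong refl)
       (simp add: rdiff_tv, simp only: Du lessThan_iff, simp add: power2_eq_square)
  moreover have "(\<Sum>x<m + 2. poly (B' x) (?u x)) =
      (\<Sum>x<m + 2. A x * ?u x) + (\<Sum>x<m + 2. poly ([:0, 0, - 1:] * pderiv (B x)) (?u x))"
    unfolding B'_def poly_add sum.distrib by (simp add: mult.commute)
  ultimately have "poly (pderiv P) (tv m) + (\<Sum>x<m + 2. poly (B' x) (?u x)) = 0"
    using 0 by (simp only: add_ac)
  then have *: "pderiv P = 0 \<and> (\<forall>x\<in>{..<m + 2}. B' x = 0)"
  proof (intro rdiff.partial_fractions_unique[of m "tv m" "{..<m + 2}" pt])
    show "rdiff.const_poly m (pderiv P)" using cP by blast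
    show "rdiff.const_poly m (B' x)" if "x \<in> {..<m + 2}" for x
      unfolding B'_def using cB[of x] A[of x] that
      by (intro rdiff.const_poly_add rdiff.const_poly_mult rdiff.const_poly_pCons rdiff.const_poly_0 rdiff.const_poly_pderiv)
         (auto simp: rdiff.uminus)
  qed (auto simp: rdiff_tv rdiff_pt inj_on_def pt_eq_iff B'_def)
  obtain p where p: "P = [:p:]" using * pderiv_iszero by blast
  have AB: "A x = 0 \<and> B x = 0" if "x < m + 2" for x
  proof -
    have B'0: "[:0, A x:] + [:0, 0, - 1:] * pderiv (B x) = 0" using * that by (simp add: B'_def)
    then have Ax: "A x = 0" using arg_cong[OF B'0, of "\<lambda>p. coeff p 1"] by simp
    with B'0 have "pderiv (B x) = 0" by auto
    then obtain b where "B x = [:b:]" using pderiv_iszero by blast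
    then show ?thesis using B(2)[rule_format, of x] Ax by simp
  qed
  then show "A x = 0" if "x < m + 2" for x using that by blast
  have "f = p" using f_eq AB p by simp
  then show "f \<in> O_ring m" using P[rule_format, of 0] p by simp
qed

lemma poles_independent:
  assumes "\<And>x. x < m + 2 \<Longrightarrow> rdiff m (A x) = 0" "(\<Sum>x<m + 2. A x * inverse (tv m - pt x)) = 0" "x < m + 2"
  shows "A x = 0"
  using O_Suc_closed(2)[of 0 m A x] assms by simp

section \<open>Integrability as rational linear relations\<close>

definition rat_const :: "rat ratfun set" where
  "rat_const = range rconst"

lemma rat_const_0 [simp]: "0 \<in> rat_const"
  using rangeI[of rconst 0] by (simp add: rat_const_def)

lemma rat_const_rconst: "rconst c \<in> rat_const"
  unfolding rat_const_def by (rule rangeI)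

lemma rat_const_add: "a \<in> rat_const \<Longrightarrow> b \<in> rat_const \<Longrightarrow> a + b \<in> rat_const"
  unfolding rat_const_def by (elim imageE) (simp only: rconst_add[symmetric] rat_const_rconst[unfolded rat_const_def])

lemma rat_const_uminus: "a \<in> rat_const \<Longrightarrow> - a \<in> rat_const"
  unfolding rat_const_def by (elim imageE) (simp only: rconst_uminus[symmetric] rat_const_rconst[unfolded rat_const_def])

lemma rat_const_diff: "a \<in> rat_const \<Longrightarrow> b \<in> rat_const \<Longrightarrow> a - b \<in> rat_const"
  using rat_const_add[of a "- b"] rat_const_uminus by simp

lemma rat_const_sum: "(\<And>x. x \<in> A \<Longrightarrow> f x \<in> rat_const) \<Longrightarrow> (\<Sum>x\<in>A. f x) \<in> rat_const"
  by (induction A rule: infinite_finite_induct) (auto intro: rat_const_add)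

lemma rat_const_O: "a \<in> rat_const \<Longrightarrow> a \<in> O_ring m"
  by (auto simp: rat_const_def intro: regular.const)

lemma rdiff_rat_const: "a \<in> rat_const \<Longrightarrow> rdiff i a = 0"
  by (auto simp: rat_const_def)

lemma dlog_coeff_fib_last: "dlog_coeff (fib m x) m = inverse (tv m - pt x)" if "x < m + 2"
  using that by (simp add: dlog_coeff_fib rdiff.diff rdiff_pt rdiff_tv divide_inverse)

text \<open>In the direction \<open>t\<^sub>m\<close> only fibre letters contribute, as distinct
  simple poles, so their coefficients vanish. The base letters follow by induction.\<close>

lemma dlog_coeff_independent:
  assumes "\<And>a. a \<in> letters m \<Longrightarrow> C a \<in> rat_const" and "\<And>i. i < m \<Longrightarrow> (\<Sum>a\<in>letters m. C a * dlog_coeff a i) = 0" and "a \<in> letters m"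
  shows "C a = 0"
  using assms
proof (induction m arbitrary: a)
  case (Suc m)
  have "(\<Sum>a\<in>letters m. C a * dlog_coeff a m) = 0" by (simp add: dlog_coeff_eq_0)
  then have "(\<Sum>x<m + 2. C (fib m x) * inverse (tv m - pt x)) = 0"
    using Suc.prems(2)[of m] unfolding sum_H_Suc by (simp add: dlog_coeff_fib_last cong: sum.cong_simp del: sum.lessThan_Suc)
  moreover have "C (fib m x) \<in> rat_const" if "x < m + 2" for x
    using Suc.prems(1) that fib_in_H by blast
  ultimately have fib0: "C (fib m x) = 0" if "x < m + 2" for x
    using poles_independent[of m "\<lambda>x. C (fib m x)" x] that rdiff_rat_const by blast
  moreover have "C a = 0" if "a \<in> letters m" for a
  proof (rule Suc.IH[OF _ _ that])
    show "(\<Sum>a\<in>letters m. C a * dlog_coeff a i) = 0" if "i < m" for i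
      using Suc.prems(2)[of i] that fib0 unfolding sum_H_Suc by (simp del: sum.lessThan_Suc)
  qed (use Suc.prems(1) letters_Suc in auto)
  ultimately show ?case using Suc.prems(3) by (auto simp: letters_Suc)
qed simp

text \<open>The coefficient of \<open>\<omega>\<^sub>a \<and> \<omega>\<^sub>f\<close>, \<open>f = fib m x\<close>, in \<open>\<Sum> C\<^sub>b\<^sub>c \<omega>\<^sub>b \<and> \<omega>\<^sub>c\<close>, after products of two forms
  \<open>\<omega>\<^sub>f\<close> along the fibre have been rewritten by Arnold's relation.\<close>

definition relations_coeff :: "nat \<Rightarrow> nat \<Rightarrow> m0_hyp \<Rightarrow> (m0_hyp \<Rightarrow> m0_hyp \<Rightarrow> rat ratfun) \<Rightarrow> rat ratfun" where
  "relations_coeff m x a C = C a (fib m x) - C (fib m x) a +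
     (\<Sum>y<m + 2. if ends a = {x, y} then C (fib m y) (fib m x) - C (fib m x) (fib m y) else 0)"

text \<open>One condition for each fibre letter and each letter of lower level. Pairs of fibre
  letters of one level give none, as their products are rewritten.\<close>

definition relations :: "nat \<Rightarrow> (m0_hyp \<Rightarrow> m0_hyp \<Rightarrow> rat ratfun) \<Rightarrow> bool" where
  "relations l C \<longleftrightarrow> (\<forall>m<l. \<forall>x<m + 2. \<forall>a\<in>letters m. relations_coeff m x a C = 0)"

definition wedge_coeff :: "nat \<Rightarrow> nat \<Rightarrow> m0_hyp \<Rightarrow> m0_hyp \<Rightarrow> rat ratfun" where
  "wedge_coeff i k a b = dlog_coeff a i * dlog_coeff b k - dlog_coeff a k * dlog_coeff b i"

lemma wedge_coeff_swap: "wedge_coeff i k a b = - wedge_coeff i k b a"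
  by (simp add: wedge_coeff_def algebra_simps)

lemma sum_letters:
  assumes "x < m + 2"
  shows "(\<Sum>a\<in>letters m. dlog_coeff a i * (\<Sum>y<m + 2. if ends a = {x, y} then f y else 0)) = (\<Sum>y<m + 2. pt_dlog x y i * f y)"
proof -
  have "(\<Sum>a\<in>letters m. dlog_coeff a i * (\<Sum>y<m + 2. if ends a = {x, y} then f y else 0)) =
      (\<Sum>a\<in>letters m. \<Sum>y<m + 2. (if ends a = {x, y} then dlog_coeff a i else 0) * f y)"
    unfolding sum_distrib_left by (intro sum.cong) auto
  also have "\<dots> = (\<Sum>y<m + 2. (\<Sum>a\<in>letters m. if ends a = {x, y} then dlog_coeff a i else 0) * f y)"
    unfolding sum_distrib_right by (rule sum.swap)
  also have "\<dots> = (\<Sum>y<m + 2. pt_dlog x y i * f y)"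
    using assms by (intro sum.cong) (auto simp: pt_dlog_conv_letters)
  finally show ?thesis .
qed

lemma sum_wedge_coeff_H_Suc:
  "(\<Sum>a\<in>letters (Suc m). \<Sum>b\<in>letters (Suc m). C a b * wedge_coeff i k a b) =
     (\<Sum>a\<in>letters m. \<Sum>b\<in>letters m. C a b * wedge_coeff i k a b)
     + (\<Sum>x<m + 2. \<Sum>a\<in>letters m. (C a (fib m x) - C (fib m x) a) * wedge_coeff i k a (fib m x))
     + (\<Sum>x<m + 2. \<Sum>y<m + 2. C (fib m x) (fib m y) * wedge_coeff i k (fib m x) (fib m y))"
proof -
  have *: "(\<Sum>a\<in>letters m. \<Sum>x<m + 2. C a (fib m x) * wedge_coeff i k a (fib m x)) +
      (\<Sum>x<m + 2. \<Sum>a\<in>letters m. C (fib m x) a * wedge_coeff i k (fib m x) a) =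
      (\<Sum>x<m + 2. \<Sum>a\<in>letters m. (C a (fib m x) - C (fib m x) a) * wedge_coeff i k a (fib m x))"
    unfolding sum.swap[of _ "{..<m + 2}" "letters m"] sum.distrib[symmetric]
    by (intro sum.cong refl) (subst (2) wedge_coeff_swap, simp add: algebra_simps)
  show ?thesis unfolding sum_H_Suc sum.distrib *[symmetric] by (simp only: add_ac)
qed

lemma wedge_coeff_fib:
  "wedge_coeff i k (fib m x) (fib m y) =
     pt_dlog x y i * (dlog_coeff (fib m y) k - dlog_coeff (fib m x) k) - pt_dlog x y k * (dlog_coeff (fib m y) i - dlog_coeff (fib m x) i)"
  using arnold_pq[of x "m + 2" i y k] by (simp add: wedge_coeff_def dlog_coeff_fib' pt_dlog_commute[of _ "m + 2"] pt_dlog_commute[of _ "Suc (Suc m)"])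

lemma sum_antisym:
  fixes f :: "'i \<Rightarrow> 'i \<Rightarrow> 'a::comm_ring"
  assumes "\<And>x y. g y x = g x y"
  shows "(\<Sum>x\<in>X. \<Sum>y\<in>X. f x y * (g x y * (h y - h x))) =
    (\<Sum>x\<in>X. \<Sum>y\<in>X. (f y x - f x y) * g x y * h x)"
proof -
  have "(\<Sum>x\<in>X. \<Sum>y\<in>X. f x y * g x y * h y) = (\<Sum>x\<in>X. \<Sum>y\<in>X. f y x * g x y * h x)"
    by (subst sum.swap) (simp only: assms)
  then show ?thesis by (simp add: algebra_simps sum_subtractf)
qed

text \<open>Arnold's relation turns products of two fibre forms into products of a base and a fibre
  form, and the hypothesis makes these cancel the mixed terms: \<open>E1\<close> and
  \<open>E2\<close> are opposite.\<close>

lemma sum_wedge_coeff_reduce: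
  assumes "\<And>x a. x < m + 2 \<Longrightarrow> a \<in> letters m \<Longrightarrow> relations_coeff m x a C = 0"
  shows "(\<Sum>a\<in>letters (Suc m). \<Sum>b\<in>letters (Suc m). C a b * wedge_coeff i k a b) = (\<Sum>a\<in>letters m. \<Sum>b\<in>letters m. C a b * wedge_coeff i k a b)"
proof -
  let ?f = "fib m"
  let ?D = "\<lambda>x y. C (?f y) (?f x) - C (?f x) (?f y)"
  have E1: "(\<Sum>x<m + 2. \<Sum>a\<in>letters m. (C a (?f x) - C (?f x) a) * wedge_coeff i k a (?f x)) =
      (\<Sum>x<m + 2. - ((\<Sum>y<m + 2. pt_dlog x y i * ?D x y) * dlog_coeff (?f x) k - (\<Sum>y<m + 2. pt_dlog x y k * ?D x y) * dlog_coeff (?f x) i))"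
  proof (rule sum.cong[OF refl])
    fix x assume "x \<in> {..<m + 2}"
    then have x: "x < m + 2" by simp
    have "(\<Sum>a\<in>letters m. (C a (?f x) - C (?f x) a) * wedge_coeff i k a (?f x)) =
        (\<Sum>a\<in>letters m. - ((dlog_coeff a i * (\<Sum>y<m + 2. if ends a = {x, y} then ?D x y else 0)) * dlog_coeff (?f x) k
           - (dlog_coeff a k * (\<Sum>y<m + 2. if ends a = {x, y} then ?D x y else 0)) * dlog_coeff (?f x) i))"
    proof (rule sum.cong[OF refl])
      fix a assume "a \<in> letters m"
      then have r: "C a (?f x) - C (?f x) a = - (\<Sum>y<m + 2. if ends a = {x, y} then ?D x y else 0)"
        using assms[OF x, of a] unfolding relations_coeff_def by (simp only: eq_neg_iff_add_eq_0)
      show "(C a (?f x) - C (?f x) a) * wedge_coeff i k a (?f x) =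
          - ((dlog_coeff a i * (\<Sum>y<m + 2. if ends a = {x, y} then ?D x y else 0)) * dlog_coeff (?f x) k
           - (dlog_coeff a k * (\<Sum>y<m + 2. if ends a = {x, y} then ?D x y else 0)) * dlog_coeff (?f x) i)"
        unfolding r wedge_coeff_def by (simp add: algebra_simps del: sum.lessThan_Suc)
    qed
    also have "\<dots> = - ((\<Sum>y<m + 2. pt_dlog x y i * ?D x y) * dlog_coeff (?f x) k - (\<Sum>y<m + 2. pt_dlog x y k * ?D x y) * dlog_coeff (?f x) i)"
      unfolding sum_negf sum_subtractf sum_distrib_right[symmetric] sum_letters[OF x] ..
    finally show "(\<Sum>a\<in>letters m. (C a (?f x) - C (?f x) a) * wedge_coeff i k a (?f x)) =
      - ((\<Sum>y<m + 2. pt_dlog x y i * ?D x y) * dlog_coeff (?f x) k - (\<Sum>y<m + 2. pt_dlog x y k * ?D x y) * dlog_coeff (?f x) i)" .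
  qed
  have E2: "(\<Sum>x<m + 2. \<Sum>y<m + 2. C (?f x) (?f y) * wedge_coeff i k (?f x) (?f y)) =
     (\<Sum>x<m + 2. (\<Sum>y<m + 2. pt_dlog x y i * ?D x y) * dlog_coeff (?f x) k - (\<Sum>y<m + 2. pt_dlog x y k * ?D x y) * dlog_coeff (?f x) i)"
    unfolding wedge_coeff_fib right_diff_distrib[of "C _ _"] sum_subtractf sum_antisym[OF pt_dlog_commute] sum_distrib_right
    by (simp only: mult_ac)
  show ?thesis unfolding sum_wedge_coeff_H_Suc E1 E2 sum_negf by (simp only: diff_add_cancel add_uminus_conv_diff)
qed

lemma relations_Suc: "relations (Suc l) C \<longleftrightarrow> relations l C \<and> (\<forall>x<l + 2. \<forall>a\<in>letters l. relations_coeff l x a C = 0)"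
  by (auto simp: relations_def less_Suc_eq)

lemma relations_imp_integrable:
  "relations l C \<Longrightarrow> (\<Sum>a\<in>letters l. \<Sum>b\<in>letters l. C a b * wedge_coeff i k a b) = 0"
proof (induction l)
  case (Suc l)
  then have "relations l C" "\<And>x a. x < l + 2 \<Longrightarrow> a \<in> letters l \<Longrightarrow> relations_coeff l x a C = 0" by (auto simp: relations_Suc)
  then show ?case using sum_wedge_coeff_reduce[of l C i k] Suc.IH by simp
qed simp

text \<open>The component at \<open>dt\<^sub>i \<and> dt\<^sub>m\<close> is a sum of simple poles in
  \<open>t\<^sub>m\<close> with coefficients from the base, so every coefficient vanishes. Each one
  is a combination of base forms with constant coefficients, and those forms are independent over
  the constants.\<close>

lemma integrable_imp_rel:
  assumes "\<And>a b. C a b \<in> rat_const" "\<And>i k. i < l \<Longrightarrow> k < l \<Longrightarrow> (\<Sum>a\<in>letters l. \<Sum>b\<in>letters l. C a b * wedge_coeff i k a b) = 0"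
  shows "relations l C"
  using assms(2)
proof (induction l)
  case 0
  then show ?case by (simp add: relations_def)
next
  case (Suc m)
  let ?f = "fib m" and ?u = "\<lambda>x. inverse (tv m - pt x)"
  have r: "relations_coeff m x a C = 0" if x: "x < m + 2" and a: "a \<in> letters m" for x a
  proof (rule dlog_coeff_independent[of m "\<lambda>a. relations_coeff m x a C"])
    show "relations_coeff m x a C \<in> rat_const" for a
      unfolding relations_coeff_def by (intro rat_const_add rat_const_diff rat_const_sum) (auto intro: rat_const_diff assms(1))
    fix i assume i: "i < m"
    have G: "(\<Sum>a\<in>letters m. relations_coeff m x a C * dlog_coeff a i) =
      (\<Sum>a\<in>letters m. (C a (?f x) - C (?f x) a) * dlog_coeff a i) + (\<Sum>y<m + 2. pt_dlog x y i * (C (?f y) (?f x) - C (?f x) (?f y)))"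
      if "x < m + 2" for x
      unfolding sum_letters[OF that, symmetric] relations_coeff_def distrib_right sum.distrib by (simp only: mult.commute)
    have 1: "(\<Sum>a\<in>letters m. (C a (?f x) - C (?f x) a) * wedge_coeff i m a (?f x)) = (\<Sum>a\<in>letters m. (C a (?f x) - C (?f x) a) * dlog_coeff a i) * ?u x"
      if "x < m + 2" for x
      unfolding sum_distrib_right using that dlog_coeff_fib_last[OF that]
      by (intro sum.cong) (simp_all add: wedge_coeff_def dlog_coeff_eq_0)
    have pqm: "pt_dlog x y m = 0" if "x < m + 2" "y < m + 2" for x y
      unfolding pt_dlog_conv_letters[OF that] by (intro sum.neutral) (auto simp: dlog_coeff_eq_0)
    have 2: "(\<Sum>x<m + 2. \<Sum>y<m + 2. C (?f x) (?f y) * wedge_coeff i m (?f x) (?f y)) =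
       (\<Sum>x<m + 2. (\<Sum>y<m + 2. pt_dlog x y i * (C (?f y) (?f x) - C (?f x) (?f y))) * ?u x)"
    proof -
      have "(\<Sum>x<m + 2. \<Sum>y<m + 2. C (?f x) (?f y) * wedge_coeff i m (?f x) (?f y)) =
        (\<Sum>x<m + 2. \<Sum>y<m + 2. C (?f x) (?f y) * (pt_dlog x y i * (?u y - ?u x)))"
        unfolding wedge_coeff_fib by (intro sum.cong refl) (simp add: pqm dlog_coeff_fib_last)
      then show ?thesis unfolding sum_antisym[OF pt_dlog_commute] sum_distrib_right by (simp only: mult_ac)
    qed
    have "(\<Sum>a\<in>letters m. \<Sum>b\<in>letters m. C a b * wedge_coeff i m a b) = 0"
      by (simp add: wedge_coeff_def dlog_coeff_eq_0)
    then have "(\<Sum>x<m + 2. (\<Sum>a\<in>letters m. relations_coeff m x a C * dlog_coeff a i) * ?u x) = 0"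
      using Suc.prems[of i m] i unfolding sum_wedge_coeff_H_Suc 2
      by (simp add: 1 G distrib_right sum.distrib cong: sum.cong_simp del: sum.lessThan_Suc)
    moreover have "rdiff m (\<Sum>a\<in>letters m. relations_coeff m x a C * dlog_coeff a i) = 0" for x
    proof (rule rdiff_O_eq_0[of _ m])
      have "relations_coeff m x a C \<in> rat_const" for a
        unfolding relations_coeff_def by (intro rat_const_add rat_const_diff rat_const_sum) (auto intro: rat_const_diff assms(1))
      then show "(\<Sum>a\<in>letters m. relations_coeff m x a C * dlog_coeff a i) \<in> O_ring m"
        by (intro O_sum regular.mult dlog_coeff_in_O rat_const_O)
    qed simp
    ultimately show "(\<Sum>a\<in>letters m. relations_coeff m x a C * dlog_coeff a i) = 0"
      using poles_independent[of m "\<lambda>x. \<Sum>a\<in>letters m. relations_coeff m x a C * dlog_coeff a i"] x by blast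
  qed (rule a)
  have "relations m C"
  proof (rule Suc.IH)
    fix i k assume "i < m" "k < m"
    then show "(\<Sum>a\<in>letters m. \<Sum>b\<in>letters m. C a b * wedge_coeff i k a b) = 0"
      using Suc.prems[of i k] sum_wedge_coeff_reduce[of m C i k] r by simp
  qed
  then show ?case using r by (simp add: relations_Suc)
qed

section \<open>Extension of integrable words along the fibre\<close>

lemma relations_coeff_add: "relations_coeff m x a (\<lambda>b c. C b c + D b c) = relations_coeff m x a C + relations_coeff m x a D"
proof -
  have "(\<Sum>y<m + 2. if ends a = {x, y} then (C (fib m y) (fib m x) + D (fib m y) (fib m x)) -
      (C (fib m x) (fib m y) + D (fib m x) (fib m y)) else 0) =
    (\<Sum>y<m + 2. if ends a = {x, y} then C (fib m y) (fib m x) - C (fib m x) (fib m y) else 0) +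
    (\<Sum>y<m + 2. if ends a = {x, y} then D (fib m y) (fib m x) - D (fib m x) (fib m y) else 0)"
    unfolding sum.distrib[symmetric] by (intro sum.cong) auto
  then show ?thesis unfolding relations_coeff_def by (simp add: algebra_simps del: sum.lessThan_Suc)
qed

lemma relations_coeff_scale: "relations_coeff m x a (\<lambda>b c. f * C b c) = f * relations_coeff m x a C"
  unfolding relations_coeff_def distrib_left sum_distrib_left
  by (intro arg_cong2[of _ _ _ _ "(+)"] sum.cong) (simp_all add: right_diff_distrib)

lemma relations_coeff_rdiff: "relations_coeff m x a (\<lambda>b c. rdiff i (C b c)) = rdiff i (relations_coeff m x a C)"
  unfolding relations_coeff_def rdiff.add rdiff.sum
  by (intro arg_cong2[of _ _ _ _ "(+)"] sum.cong) (simp_all add: rdiff.diff)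

lemma relations_0: "relations l (\<lambda>b c. 0)"
  by (simp add: relations_def relations_coeff_def del: sum.lessThan_Suc cong: if_cong)

lemma relations_add: "relations l C \<Longrightarrow> relations l D \<Longrightarrow> relations l (\<lambda>b c. C b c + D b c)"
  by (simp add: relations_def relations_coeff_add)

lemma relations_scale: "relations l C \<Longrightarrow> relations l (\<lambda>b c. f * C b c)"
  by (simp add: relations_def relations_coeff_scale)

lemma relations_rdiff: "relations l C \<Longrightarrow> relations l (\<lambda>b c. rdiff i (C b c))"
  by (simp add: relations_def relations_coeff_rdiff)

section \<open>Integrable families of functions on words\<close>

type_synonym family = "m0_hyp list \<Rightarrow> rat ratfun"

text \<open>The solutions with rational values on words of length \<open>m\<close> (\<open>pure l m\<close> below) form the paper's
  \<open>V\<^sub>m\<close>; those of bounded length with values in \<open>\<O>\<^sub>M\<close> (\<open>W l\<close> below) form \<open>B(M)\<close>.\<close>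

definition V :: "nat \<Rightarrow> family set" where
  "V l = {X. (\<forall>w. \<not> set w \<subseteq> letters l \<longrightarrow> X w = 0) \<and> (\<forall>u v. relations l (\<lambda>a b. X (u @ [a, b] @ v)))}"

lemma V_0: "(\<lambda>w. 0) \<in> V l"
  by (simp add: V_def relations_0)

lemma V_add: "X \<in> V l \<Longrightarrow> Y \<in> V l \<Longrightarrow> (\<lambda>w. X w + Y w) \<in> V l"
  by (simp add: V_def relations_add)

lemma V_scale: "X \<in> V l \<Longrightarrow> (\<lambda>w. f * X w) \<in> V l"
  by (simp add: V_def relations_scale)

lemma V_sum: "(\<And>x. x \<in> A \<Longrightarrow> X x \<in> V l) \<Longrightarrow> (\<lambda>w. \<Sum>x\<in>A. X x w) \<in> V l"
  by (induction A rule: infinite_finite_induct) (simp_all add: V_0 V_add)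

lemma V_diff: "X \<in> V l \<Longrightarrow> Y \<in> V l \<Longrightarrow> (\<lambda>w. X w - Y w) \<in> V l"
  using V_add[of X l "\<lambda>w. - 1 * Y w"] V_scale[of Y l "- 1"] by simp

lemma V_rdiff: "X \<in> V l \<Longrightarrow> (\<lambda>w. rdiff i (X w)) \<in> V l"
  by (simp add: V_def relations_rdiff)

lemma V_tail: "X \<in> V l \<Longrightarrow> (\<lambda>w. X (a # w)) \<in> V l"
proof -
  assume X: "X \<in> V l"
  have "relations l (\<lambda>b c. X ((a # u) @ [b, c] @ v))" for u v
    using X by (simp only: V_def mem_Collect_eq)
  then show ?thesis using X by (simp add: V_def)
qed

lemma V_outside: "X \<in> V l \<Longrightarrow> \<not> set w \<subseteq> letters l \<Longrightarrow> X w = 0"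
  by (simp add: V_def)

lemma V_relations_coeff:
  assumes "X \<in> V (Suc m)" "x < m + 2" "a \<in> letters m"
  shows "relations_coeff m x a (\<lambda>a b. X (u @ [a, b] @ v)) = 0"
  using assms by (simp add: V_def relations_Suc)

lemma V_relations_coeff_Nil:
  assumes "X \<in> V (Suc m)" "x < m + 2" "a \<in> letters m"
  shows "relations_coeff m x a (\<lambda>a b. X (a # b # v)) = 0"
  using V_relations_coeff[OF assms, of "[]" v] by simp

text \<open>The relation moves a fibre letter in front of the base letter before it; the correction
  words have a fibre letter in that earlier place as well. So fibre letters travel to the front,
  where the family is zero.\<close>

lemma V_vanish:
  assumes X: "X \<in> V (Suc m)" and 0: "\<And>x w. x < m + 2 \<Longrightarrow> X (fib m x # w) = 0" and w: "\<not> set w \<subseteq> letters m"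
  shows "X w = 0"
proof -
  have *: "X (u @ fib m x # v) = 0" if "x < m + 2" for u v x
    using that
  proof (induction "length u" arbitrary: u v x rule: less_induct)
    case less
    show ?case
    proof (cases u rule: rev_cases)
      case Nil
      then show ?thesis using 0 less.prems by simp
    next
      case (snoc u' a)
      consider "a \<in> letters m" | y where "y < m + 2" "a = fib m y" | "a \<notin> letters (Suc m)" by (auto simp: letters_Suc)
      then show ?thesis
      proof cases
        case 1
        have IH: "X (u' @ fib m y # v') = 0" if "y < m + 2" for y v'
          using less.hyps[of u' y v'] snoc that by simp
        have "(\<Sum>y<m + 2. if ends a = {x, y} then X (u' @ [fib m y, fib m x] @ v) - X (u' @ [fib m x, fib m y] @ v) else 0) = 0"
          using less.prems by (intro sum.neutral) (auto simp: IH)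
        then have "X (u' @ [a, fib m x] @ v) - X (u' @ [fib m x, a] @ v) = 0"
          using V_relations_coeff[OF X less.prems 1, of u' v] unfolding relations_coeff_def by simp
        then show ?thesis using IH[of x "a # v"] less.prems snoc by simp
      next
        case 2
        then show ?thesis using less.hyps[of u' y "fib m x # v"] snoc by simp
      next
        case 3
        then show ?thesis using V_outside[OF X, of "u @ fib m x # v"] snoc by simp
      qed
    qed
  qed
  show ?thesis
  proof (cases "set w \<subseteq> letters (Suc m)")
    case True
    then obtain x where "x < m + 2" "fib m x \<in> set w" using w by (auto simp: letters_Suc)
    then show ?thesis using * by (metis split_list)
  qed (rule V_outside[OF X])
qed

definition pure :: "nat \<Rightarrow> nat \<Rightarrow> family set" where
  "pure l n = {X \<in> V l. \<forall>w. X w \<in> rat_const \<and> (length w \<noteq> n \<longrightarrow> X w = 0)}"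

lemma pure_0: "(\<lambda>w. 0) \<in> pure l n"
  by (simp add: pure_def V_0)

lemma pure_add: "X \<in> pure l n \<Longrightarrow> Y \<in> pure l n \<Longrightarrow> (\<lambda>w. X w + Y w) \<in> pure l n"
  by (simp add: pure_def V_add rat_const_add)

lemma pure_diff: "X \<in> pure l n \<Longrightarrow> Y \<in> pure l n \<Longrightarrow> (\<lambda>w. X w - Y w) \<in> pure l n"
  by (simp add: pure_def V_diff rat_const_diff)

lemma pure_sum: "(\<And>x. x \<in> A \<Longrightarrow> X x \<in> pure l n) \<Longrightarrow> (\<lambda>w. \<Sum>x\<in>A. X x w) \<in> pure l n"
  by (induction A rule: infinite_finite_induct) (simp_all add: pure_0 pure_add)

lemma pure_tail: "X \<in> pure l (Suc n) \<Longrightarrow> (\<lambda>w. X (a # w)) \<in> pure l n"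
  by (simp add: pure_def V_tail)

lemma pure_if: "(P \<Longrightarrow> X \<in> pure l n) \<Longrightarrow> (\<lambda>w. if P then X w else 0) \<in> pure l n"
  by (cases P) (simp_all add: pure_0)

section \<open>The linear part of the connection on the base and its curvature\<close>

definition base_nabla :: "nat \<Rightarrow> nat \<Rightarrow> family \<Rightarrow> family" where
  "base_nabla m i X w = (\<Sum>a\<in>letters m. dlog_coeff a i * X (a # w))"

lemma V_Theta: "(\<And>a. a \<in> letters m \<Longrightarrow> (\<lambda>w. X (a # w)) \<in> V l) \<Longrightarrow> base_nabla m i X \<in> V l"
  unfolding base_nabla_def[abs_def] by (intro V_sum V_scale)

lemma base_nabla_diff: "base_nabla m i (\<lambda>w. X w - Y w) w = base_nabla m i X w - base_nabla m i Y w"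
  by (simp add: base_nabla_def right_diff_distrib sum_subtractf)

lemma base_nabla_sum: "base_nabla m i (\<lambda>w. \<Sum>y\<in>A. f y * X y w) w = (\<Sum>y\<in>A. f y * base_nabla m i (X y) w)"
  unfolding base_nabla_def sum_distrib_left by (subst sum.swap) (simp add: mult_ac)

text \<open>The relation moves the removed base letter behind \<open>fib m x\<close>; the
  corrections are summed up by \<open>sum_letters\<close>. Only relations in the two leading letters
  are assumed, because this is applied to families not yet known to lie in \<open>V\<close>.\<close>

lemma base_nabla_fib:
  assumes "x < m + 2" "\<And>a. a \<in> letters m \<Longrightarrow> relations_coeff m x a (\<lambda>a b. X (a # b # w)) = 0"
  shows "base_nabla m i X (fib m x # w) = base_nabla m i (\<lambda>w. X (fib m x # w)) w -
    (\<Sum>y<m + 2. pt_dlog x y i * (X (fib m y # fib m x # w) - X (fib m x # fib m y # w)))"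
  unfolding base_nabla_def sum_letters[OF assms(1), symmetric] sum_subtractf[symmetric]
proof (rule sum.cong[OF refl])
  fix a assume "a \<in> letters m"
  from assms(2)[OF this] have "X (a # fib m x # w) = X (fib m x # a # w) -
      (\<Sum>y<m + 2. if ends a = {x, y} then X (fib m y # fib m x # w) - X (fib m x # fib m y # w) else 0)"
    unfolding relations_coeff_def by (simp add: algebra_simps eq_neg_iff_add_eq_0 del: sum.lessThan_Suc)
  then show "dlog_coeff a i * X (a # fib m x # w) = dlog_coeff a i * X (fib m x # a # w) - dlog_coeff a i *
      (\<Sum>y<m + 2. if ends a = {x, y} then X (fib m y # fib m x # w) - X (fib m x # fib m y # w) else 0)"
    by (simp only: right_diff_distrib)
qed

text \<open>The curvature of the linear part: its vanishing is the integrability of \<open>X\<close>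
  in the two leading letters.\<close>

lemma base_nabla_commutator:
  "base_nabla m k (base_nabla m i X) w - base_nabla m i (base_nabla m k X) w = (\<Sum>a\<in>letters m. \<Sum>b\<in>letters m. X (a # b # w) * wedge_coeff i k a b)"
proof -
  have "base_nabla m k (base_nabla m i X) w = (\<Sum>a\<in>letters m. \<Sum>b\<in>letters m. X (a # b # w) * (dlog_coeff a i * dlog_coeff b k))" for i k
    unfolding base_nabla_def sum_distrib_left by (subst sum.swap) (simp add: mult_ac)
  then show ?thesis by (simp add: wedge_coeff_def right_diff_distrib sum_subtractf mult.commute)
qed

text \<open>The antisymmetry of \<open>P\<close> kills the terms in \<open>d\<close>; those in
  \<open>c\<close> and \<open>e\<close> cancel after \<open>y\<close> and \<open>z\<close> are
  exchanged in one of the sums. In the application the second hypothesis is Arnold's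
  relation.\<close>

lemma double_sum_cancel:
  fixes P Q :: "'i \<Rightarrow> 'i \<Rightarrow> 'a::comm_ring"
  assumes "\<And>y z. P z y = - P y z" "\<And>y z. P y z = Q y z - Q z y"
  shows "(\<Sum>y\<in>A. \<Sum>z\<in>A. P y z * (c y z - d y z - d z y + e y z) + Q y z * (c z y - c y z - e y z + e z y)) = 0"
proof -
  have "(\<Sum>y\<in>A. \<Sum>z\<in>A. P y z * (c y z - d y z - d z y + e y z) + Q y z * (c z y - c y z - e y z + e z y)) =
    (\<Sum>y\<in>A. \<Sum>z\<in>A. P y z * (c y z + e y z) - Q y z * (c y z + e y z)) - (\<Sum>y\<in>A. \<Sum>z\<in>A. P y z * d y z)
     - (\<Sum>y\<in>A. \<Sum>z\<in>A. P y z * d z y) + (\<Sum>y\<in>A. \<Sum>z\<in>A. Q y z * (c z y + e z y))"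
    unfolding sum_subtractf[symmetric] sum.distrib[symmetric] by (intro sum.cong refl) (simp add: algebra_simps)
  also have "(\<Sum>y\<in>A. \<Sum>z\<in>A. P y z * d z y) = - (\<Sum>y\<in>A. \<Sum>z\<in>A. P y z * d y z)"
    unfolding sum_negf[symmetric] by (subst sum.swap, intro sum.cong refl, subst assms(1), simp)
  also have "(\<Sum>y\<in>A. \<Sum>z\<in>A. Q y z * (c z y + e z y)) = (\<Sum>y\<in>A. \<Sum>z\<in>A. Q z y * (c y z + e y z))"
    by (rule sum.swap)
  also have "(\<Sum>y\<in>A. \<Sum>z\<in>A. P y z * (c y z + e y z) - Q y z * (c y z + e y z)) =
      - (\<Sum>y\<in>A. \<Sum>z\<in>A. Q z y * (c y z + e y z))"
    unfolding sum_negf[symmetric] assms(2) by (intro sum.cong refl) (simp add: algebra_simps)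
  finally show ?thesis by simp
qed

text \<open>Flatness of the base connection on words that start with a fibre letter. This is
  dual to the infinitesimal braid relations of the base acting on the free Lie algebra of the
  fibre, and it reduces to Arnold's relation.\<close>

lemma base_nabla_commutator_fib:
  assumes Y: "\<And>x. x < m + 2 \<Longrightarrow> (\<lambda>w. X (fib m x # w)) \<in> V (Suc m)"
    and Z: "\<And>a. a \<in> letters m \<Longrightarrow> (\<lambda>w. X (a # w)) \<in> V (Suc m)"
    and r: "\<And>x a w. x < m + 2 \<Longrightarrow> a \<in> letters m \<Longrightarrow> relations_coeff m x a (\<lambda>a b. X (a # b # w)) = 0"
    and x: "x < m + 2"
  shows "base_nabla m k (base_nabla m i X) (fib m x # w) = base_nabla m i (base_nabla m k X) (fib m x # w)"
proof -
  let ?S = "{..<m + 2}" and ?f = "fib m"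
  define Yx where "Yx x w = X (?f x # w)" for x w
  have YV: "Yx x \<in> V (Suc m)" if "x < m + 2" for x
    unfolding Yx_def[abs_def] by (rule Y[OF that])
  define th where "th i y z = base_nabla m i (\<lambda>w. Yx y (?f z # w)) w" for i y z
  have T: "base_nabla m i X (?f x # w) = base_nabla m i (Yx x) w -
      (\<Sum>y\<in>?S. pt_dlog x y i * (Yx y (?f x # w) - Yx x (?f y # w)))" if "x < m + 2" for i x w
    using base_nabla_fib[OF that, of X w i] r that by (simp only: Yx_def[abs_def])
  have TY: "base_nabla m i (Yx y) (?f x # w) = th i y x -
      (\<Sum>z\<in>?S. pt_dlog x z i * (Yx y (?f z # ?f x # w) - Yx y (?f x # ?f z # w)))" if "x < m + 2" "y < m + 2" for i x y
    using base_nabla_fib[OF that(1), of "Yx y" w i] V_relations_coeff_Nil[OF YV[OF that(2)] that(1)] by (simp only: th_def)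
  have ThV: "base_nabla m i X \<in> V (Suc m)" for i by (intro V_Theta Z)
  have TT: "base_nabla m k (base_nabla m i X) (?f x # w) =
      base_nabla m k (\<lambda>w. base_nabla m i X (?f x # w)) w -
      (\<Sum>y\<in>?S. pt_dlog x y k * (base_nabla m i X (?f y # ?f x # w) - base_nabla m i X (?f x # ?f y # w)))" for i k
    by (rule base_nabla_fib[OF x V_relations_coeff_Nil[OF ThV x]])
  have 1: "base_nabla m k (\<lambda>w. base_nabla m i X (?f x # w)) w =
      base_nabla m k (base_nabla m i (Yx x)) w - (\<Sum>y\<in>?S. pt_dlog x y i * (th k y x - th k x y))" for i k
    unfolding T[OF x] base_nabla_diff base_nabla_sum th_def by simp
  \<comment> \<open>The words in the three fibre letters that arise from two exchanges, sorted by
    the place of \<open>x\<close>: last in \<open>c\<close>, in the middle in \<open>d\<close>,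
    first in \<open>e\<close>.\<close>
  define c where "c y z = Yx y (?f z # ?f x # w)" for y z
  define d where "d y z = Yx y (?f x # ?f z # w)" for y z
  define e where "e y z = Yx x (?f z # ?f y # w)" for y z
  have 2: "pt_dlog x y k * (base_nabla m i X (?f y # ?f x # w) - base_nabla m i X (?f x # ?f y # w)) =
      pt_dlog x y k * (th i y x - th i x y) -
      (\<Sum>z\<in>?S. pt_dlog x y k * pt_dlog x z i * (c y z - d y z - d z y + e y z) +
        pt_dlog x y k * pt_dlog y z i * (c z y - c y z - e y z + e z y))" if "y \<in> ?S" for y i k
  proof -
    have y: "y < m + 2" using that by simp
    show ?thesis
      unfolding T[OF x] T[OF y] TY[OF x y] TY[OF y x] c_def d_def e_def
      by (simp add: algebra_simps sum.distrib sum_subtractf sum_distrib_left del: sum.lessThan_Suc)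
  qed
  \<comment> \<open>All but the double sum is symmetric in \<open>i\<close> and \<open>k\<close>:
    the single sums trade places, and the leading term is symmetric because \<open>Yx x\<close> is
    integrable.\<close>
  have A: "base_nabla m k (base_nabla m i X) (?f x # w) = base_nabla m k (base_nabla m i (Yx x)) w
      - (\<Sum>y\<in>?S. pt_dlog x y i * (th k y x - th k x y)) - (\<Sum>y\<in>?S. pt_dlog x y k * (th i y x - th i x y))
      + (\<Sum>y\<in>?S. \<Sum>z\<in>?S. pt_dlog x y k * pt_dlog x z i * (c y z - d y z - d z y + e y z) +
        pt_dlog x y k * pt_dlog y z i * (c z y - c y z - e y z + e z y))" for i k
  proof -
    have "(\<Sum>y\<in>?S. pt_dlog x y k * (base_nabla m i X (?f y # ?f x # w) - base_nabla m i X (?f x # ?f y # w))) =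
      (\<Sum>y\<in>?S. pt_dlog x y k * (th i y x - th i x y)) - (\<Sum>y\<in>?S. \<Sum>z\<in>?S. pt_dlog x y k * pt_dlog x z i * (c y z - d y z - d z y + e y z) +
        pt_dlog x y k * pt_dlog y z i * (c z y - c y z - e y z + e z y))"
      unfolding sum_subtractf[symmetric] by (rule sum.cong[OF refl 2])
    then show ?thesis unfolding TT 1 by simp
  qed
  have "(\<Sum>a\<in>letters m. \<Sum>b\<in>letters m. Yx x (a # b # w) * wedge_coeff i k a b) = 0"
  proof (rule relations_imp_integrable)
    have "relations (Suc m) (\<lambda>a b. Yx x ([] @ [a, b] @ w))"
      using YV[OF x] by (simp only: V_def mem_Collect_eq)
    then show "relations m (\<lambda>a b. Yx x (a # b # w))" by (simp add: relations_Suc)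
  qed
  then have 0: "base_nabla m k (base_nabla m i (Yx x)) w = base_nabla m i (base_nabla m k (Yx x)) w"
    using base_nabla_commutator[of m k i "Yx x" w] by simp
  define P where "P y z = pt_dlog x y k * pt_dlog x z i - pt_dlog x y i * pt_dlog x z k" for y z
  define Q where "Q y z = pt_dlog x y k * pt_dlog y z i - pt_dlog x y i * pt_dlog y z k" for y z
  have "(\<Sum>y\<in>?S. \<Sum>z\<in>?S. P y z * (c y z - d y z - d z y + e y z) + Q y z * (c z y - c y z - e y z + e z y)) = 0"
  proof (rule double_sum_cancel)
    show "P z y = - P y z" for y z by (simp add: P_def)
    show "P y z = Q y z - Q z y" for y z
      using arnold_pq[of y x i z k] pt_dlog_commute[of y x] pt_dlog_commute[of z x] pt_dlog_commute[of z y]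
      unfolding P_def Q_def by (simp add: algebra_simps)
  qed
  moreover have "(\<Sum>y\<in>?S. \<Sum>z\<in>?S. pt_dlog x y k * pt_dlog x z i * (c y z - d y z - d z y + e y z) +
        pt_dlog x y k * pt_dlog y z i * (c z y - c y z - e y z + e z y)) -
      (\<Sum>y\<in>?S. \<Sum>z\<in>?S. pt_dlog x y i * pt_dlog x z k * (c y z - d y z - d z y + e y z) +
        pt_dlog x y i * pt_dlog y z k * (c z y - c y z - e y z + e z y)) =
      (\<Sum>y\<in>?S. \<Sum>z\<in>?S. P y z * (c y z - d y z - d z y + e y z) + Q y z * (c z y - c y z - e y z + e z y))"
    unfolding sum_subtractf[symmetric] P_def Q_def by (intro sum.cong refl) (simp add: algebra_simps)
  ultimately have eq: "(\<Sum>y\<in>?S. \<Sum>z\<in>?S. pt_dlog x y k * pt_dlog x z i * (c y z - d y z - d z y + e y z) +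
        pt_dlog x y k * pt_dlog y z i * (c z y - c y z - e y z + e z y)) =
      (\<Sum>y\<in>?S. \<Sum>z\<in>?S. pt_dlog x y i * pt_dlog x z k * (c y z - d y z - d z y + e y z) +
        pt_dlog x y i * pt_dlog y z k * (c z y - c y z - e y z + e z y))"
    by (simp only: eq_iff_diff_eq_0[symmetric])
  show ?thesis unfolding A[of k i] A[of i k] 0 eq by (simp only: algebra_simps)
qed

text \<open>The letters of the base are extended first; they are then forced on words that start with
  a fibre letter, and the integrability of the result in two base letters is automatic.\<close>

lemma fibre_extension_step:
  assumes Y: "\<And>x. x < m + 2 \<Longrightarrow> Y x \<in> pure (Suc m) n"
    and Z: "\<And>a. a \<in> letters m \<Longrightarrow> Z a \<in> pure (Suc m) n"
      "\<And>a w. a \<in> letters m \<Longrightarrow> set w \<subseteq> letters m \<Longrightarrow> Z a w = 0"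
      "\<And>a x w. a \<in> letters m \<Longrightarrow> x < m + 2 \<Longrightarrow> Z a (fib m x # w) = Y x (a # w) -
         (\<Sum>y<m + 2. if ends a = {x, y} then Y y (fib m x # w) - Y x (fib m y # w) else 0)"
  shows "\<exists>X\<in>pure (Suc m) (Suc n). (\<forall>x<m + 2. \<forall>w. X (fib m x # w) = Y x w) \<and> (\<forall>w. set w \<subseteq> letters m \<longrightarrow> X w = 0)"
proof -
  \<comment> \<open>What follows the first letter \<open>b\<close>. As \<open>fib m\<close> is
    injective, the sum picks the one \<open>Y x\<close> that belongs to \<open>b\<close>, and
    letters outside the alphabet get 0.\<close>
  define G where "G b w = (if b \<in> letters m then Z b w else (\<Sum>x<m + 2. if b = fib m x then Y x w else 0))" for b w
  define X where "X w = (case w of [] \<Rightarrow> 0 | b # v \<Rightarrow> G b v)" for w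
  have XC: "X (b # v) = G b v" for b v by (simp add: X_def)
  have GZ: "G b = Z b" if "b \<in> letters m" for b using that by (simp add: G_def fun_eq_iff)
  have GY: "G (fib m x) = Y x" if "x < m + 2" for x
  proof (rule ext)
    fix w
    have "(\<Sum>z<m + 2. if fib m x = fib m z then Y z w else 0) = (\<Sum>z<m + 2. if z = x then Y x w else 0)"
      by (intro sum.cong) (auto simp: fib_eq_iff)
    also have "\<dots> = Y x w" using that by simp
    finally show "G (fib m x) w = Y x w" using fib_notin_H[of m m x] by (simp only: G_def order.refl if_False simp_thms)
  qed
  have G: "G b \<in> pure (Suc m) n" for b
  proof (cases "b \<in> letters m")
    case False
    then have "G b = (\<lambda>w. \<Sum>x<m + 2. if b = fib m x then Y x w else 0)" by (simp only: G_def[abs_def] if_False)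
    also have "\<dots> \<in> pure (Suc m) n" by (intro pure_sum pure_if Y) simp
    finally show ?thesis .
  qed (simp add: GZ Z(1))
  then have GV: "G b \<in> V (Suc m)" for b by (simp add: pure_def)
  have XV: "(\<lambda>w. X (b # w)) \<in> V (Suc m)" for b using GV[of b] by (simp add: XC)
  have Xr: "relations_coeff m x a (\<lambda>a b. X (a # b # w)) = 0" if "x < m + 2" "a \<in> letters m" for x a w
  proof -
    have "(\<Sum>y<m + 2. if ends a = {x, y} then X (fib m y # fib m x # w) - X (fib m x # fib m y # w) else 0) =
      (\<Sum>y<m + 2. if ends a = {x, y} then Y y (fib m x # w) - Y x (fib m y # w) else 0)"
      using that by (intro sum.cong) (auto simp: XC GY simp del: add_2_eq_Suc')
    then show ?thesis unfolding relations_coeff_def using that by (simp only: XC GY GZ Z(3)) simp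
  qed
  have X0: "X w = 0" if "set w \<subseteq> letters m" for w
    using that by (cases w) (auto simp: XC GZ Z(2) X_def[of "[]"])
  have Xout: "X w = 0" if "\<not> set w \<subseteq> letters (Suc m)" for w
  proof (cases w)
    case (Cons b v)
    show ?thesis
    proof (cases "b \<in> letters (Suc m)")
      case True
      then show ?thesis using V_outside[OF GV[of b], of v] that Cons by (simp add: XC)
    next
      case False
      then show ?thesis using Cons by (auto simp: XC G_def letters_Suc intro!: sum.neutral)
    qed
  qed (use that in simp)
  have XQ: "X w \<in> rat_const" and Xlen: "length w \<noteq> Suc n \<Longrightarrow> X w = 0" for w
    using G by (cases w; simp add: X_def pure_def)+
  have flat: "(\<Sum>a\<in>letters m. \<Sum>b\<in>letters m. X (a # b # w) * wedge_coeff i k a b) = 0" for i k w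
  proof -
    \<comment> \<open>The curvature involves \<open>X\<close> only with leading letters removed, so
      it lies in \<open>V\<close> although this is not yet known of \<open>X\<close>. Hence
      \<open>V_vanish\<close> applies to it.\<close>
    define U where "U w = base_nabla m k (base_nabla m i X) w - base_nabla m i (base_nabla m k X) w" for w
    have UV: "U \<in> V (Suc m)"
      unfolding U_def[abs_def] by (intro V_diff V_Theta V_tail XV)
    have U1: "U w = 0" if "set w \<subseteq> letters m" for w
      unfolding U_def base_nabla_commutator using that by (intro sum.neutral ballI) (simp add: X0)
    have "U w = 0"
    proof (cases "set w \<subseteq> letters m")
      case False
      show ?thesis
      proof (rule V_vanish[OF UV _ False])
        fix x w assume x: "x < m + 2"
        have "base_nabla m k (base_nabla m i X) (fib m x # w) = base_nabla m i (base_nabla m k X) (fib m x # w)"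
          by (rule base_nabla_commutator_fib[OF XV XV Xr x])
        then show "U (fib m x # w) = 0" by (simp add: U_def)
      qed
    qed (rule U1)
    then show ?thesis unfolding U_def base_nabla_commutator .
  qed
  have "relations (Suc m) (\<lambda>a b. X (u @ [a, b] @ v))" for u v
  proof (cases u)
    case Nil
    have "relations m (\<lambda>a b. X (a # b # v))"
      by (rule integrable_imp_rel[OF XQ flat])
    then show ?thesis using Xr Nil by (simp add: relations_Suc)
  next
    case (Cons b u')
    have "relations (Suc m) (\<lambda>a c. G b (u' @ [a, c] @ v))" using GV[of b] by (simp only: V_def mem_Collect_eq)
    then show ?thesis using Cons by (simp add: XC)
  qed
  then have "X \<in> pure (Suc m) (Suc n)"
    unfolding pure_def V_def using Xout XQ Xlen by blast
  then show ?thesis using X0 GY by (intro bexI[of _ X]) (auto simp: XC)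
qed

text \<open>The continuation \<open>Z a\<close> of a base letter is prescribed only on words that
  begin with a fibre letter, namely by \<open>R a\<close>. These data are one letter shorter than
  \<open>Y\<close>, so the induction hypothesis extends them.\<close>

lemma fibre_extension:
  assumes "\<And>x. x < m + 2 \<Longrightarrow> Y x \<in> pure (Suc m) n"
  shows "\<exists>X\<in>pure (Suc m) (Suc n). (\<forall>x<m + 2. \<forall>w. X (fib m x # w) = Y x w) \<and> (\<forall>w. set w \<subseteq> letters m \<longrightarrow> X w = 0)"
  using assms
proof (induction n arbitrary: Y)
  case 0
  show ?case
  \<comment> \<open>Families supported on the empty word vanish once a letter is in front, so all
    corrections are 0.\<close>
  proof (rule fibre_extension_step[of m Y 0 "\<lambda>a w. 0"])
    fix a x w assume "a \<in> letters m" "x < m + 2"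
    have "Y y (b # v) = 0" if "y < m + 2" for y b v using 0[OF that] by (simp add: pure_def)
    then show "0 = Y x (a # w) - (\<Sum>y<m + 2. if ends a = {x, y} then Y y (fib m x # w) - Y x (fib m y # w) else 0)"
      using \<open>x < m + 2\<close> by (subst sum.neutral) auto
  qed (use 0 pure_0 in auto)
next
  case (Suc n)
  define R where "R a x w = Y x (a # w) -
      (\<Sum>y<m + 2. if ends a = {x, y} then Y y (fib m x # w) - Y x (fib m y # w) else 0)" for a x w
  have "R a x \<in> pure (Suc m) n" if "x < m + 2" for a x
    unfolding R_def[abs_def] using that
    by (intro pure_diff pure_sum pure_if pure_tail Suc.prems) simp_all
  then have "\<exists>X. X\<in>pure (Suc m) (Suc n) \<and> (\<forall>x<m + 2. \<forall>w. X (fib m x # w) = R a x w) \<and> (\<forall>w. set w \<subseteq> letters m \<longrightarrow> X w = 0)" for a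
    using Suc.IH[of "R a"] by blast
  then obtain Z where "\<And>a. Z a \<in> pure (Suc m) (Suc n)" "\<And>a x w. x < m + 2 \<Longrightarrow> Z a (fib m x # w) = R a x w"
    "\<And>a w. set w \<subseteq> letters m \<Longrightarrow> Z a w = 0" by metis
  then show ?case by (intro fibre_extension_step[of m Y "Suc n" Z]) (simp_all only: Suc.prems R_def)
qed

section \<open>The connection\<close>

definition W :: "nat \<Rightarrow> family set" where
  "W l = {X \<in> V l. (\<forall>w. X w \<in> O_ring l) \<and> (\<exists>N. \<forall>w. N < length w \<longrightarrow> X w = 0)}"

lemma W_V: "X \<in> W l \<Longrightarrow> X \<in> V l" and W_O: "X \<in> W l \<Longrightarrow> X w \<in> O_ring l"
  by (simp_all add: W_def)

lemma W_bound: "X \<in> W l \<Longrightarrow> \<exists>N. \<forall>w. N < length w \<longrightarrow> X w = 0"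
  by (simp add: W_def)

lemma W_0: "(\<lambda>w. 0) \<in> W l"
  by (simp add: W_def V_0)

lemma W_add:
  assumes "X \<in> W l" "Y \<in> W l"
  shows "(\<lambda>w. X w + Y w) \<in> W l"
proof -
  obtain M N where "\<forall>w. M < length w \<longrightarrow> X w = 0" "\<forall>w. N < length w \<longrightarrow> Y w = 0"
    using assms W_bound by meson
  then have "\<forall>w. max M N < length w \<longrightarrow> X w + Y w = 0" by simp
  moreover have "X w + Y w \<in> O_ring l" for w using assms by (intro regular.add W_O)
  ultimately show ?thesis using assms V_add[of X l Y] unfolding W_def by blast
qed

lemma W_scale:
  assumes "X \<in> W l" "f \<in> O_ring l"
  shows "(\<lambda>w. f * X w) \<in> W l"
proof -
  obtain N where "\<forall>w. N < length w \<longrightarrow> X w = 0" using assms W_bound by meson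
  then have "\<forall>w. N < length w \<longrightarrow> f * X w = 0" by simp
  moreover have "f * X w \<in> O_ring l" for w using assms by (simp add: regular.mult W_O)
  ultimately show ?thesis using assms V_scale[of X l f] unfolding W_def by blast
qed

lemma W_sum: "(\<And>x. x \<in> A \<Longrightarrow> X x \<in> W l) \<Longrightarrow> (\<lambda>w. \<Sum>x\<in>A. X x w) \<in> W l"
  by (induction A rule: infinite_finite_induct) (simp_all add: W_0 W_add)

lemma W_diff: "X \<in> W l \<Longrightarrow> Y \<in> W l \<Longrightarrow> (\<lambda>w. X w - Y w) \<in> W l"
  using W_add[of X l "\<lambda>w. - 1 * Y w"] W_scale[of Y l "- 1"] O_uminus[OF O_1] by simp

lemma W_tail:
  assumes "X \<in> W l"
  shows "(\<lambda>w. X (a # w)) \<in> W l"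
proof -
  obtain N where "\<forall>w. N < length w \<longrightarrow> X w = 0" using assms W_bound by meson
  then have "\<forall>w. N < length w \<longrightarrow> X (a # w) = 0" by simp
  then show ?thesis using V_tail[of X l a] assms unfolding W_def by blast
qed

lemma W_rdiff:
  assumes "X \<in> W l"
  shows "(\<lambda>w. rdiff i (X w)) \<in> W l"
proof -
  obtain N where "\<forall>w. N < length w \<longrightarrow> X w = 0" using assms W_bound by meson
  then have "\<forall>w. N < length w \<longrightarrow> rdiff i (X w) = 0" by simp
  then show ?thesis using V_rdiff[of X l i] assms rdiff_O unfolding W_def by blast
qed

lemma pure_W:
  assumes "X \<in> pure l n"
  shows "X \<in> W l"
proof -
  have "\<forall>w. n < length w \<longrightarrow> X w = 0" using assms by (simp add: pure_def)
  then show ?thesis using assms rat_const_O unfolding W_def pure_def by blast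
qed

definition nabla :: "nat \<Rightarrow> nat \<Rightarrow> family \<Rightarrow> family" where
  "nabla l i X w = rdiff i (X w) + (\<Sum>a\<in>letters l. dlog_coeff a i * X (a # w))"

lemma nabla_0 [simp]: "nabla l i (\<lambda>w. 0) w = 0"
  by (simp add: nabla_def)

lemma nabla_add: "nabla l i (\<lambda>w. X w + Y w) w = nabla l i X w + nabla l i Y w"
  by (simp add: nabla_def rdiff.add distrib_left sum.distrib)

lemma nabla_scale: "rdiff i f = 0 \<Longrightarrow> nabla l i (\<lambda>w. f * X w) w = f * nabla l i X w"
  by (simp add: nabla_def rdiff.mult distrib_left sum_distrib_left mult.left_commute)

lemma nabla_sum: "nabla l i (\<lambda>w. \<Sum>x\<in>A. X x w) w = (\<Sum>x\<in>A. nabla l i (X x) w)"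
  by (induction A rule: infinite_finite_induct) (simp_all add: nabla_add)

lemma nabla_diff: "nabla l i (\<lambda>w. X w - Y w) w = nabla l i X w - nabla l i Y w"
  by (simp add: nabla_def rdiff.diff right_diff_distrib sum_subtractf)

lemma nabla_reduce:
  assumes "X \<in> V m" "m \<le> l"
  shows "nabla l i X w = rdiff i (X w) + (\<Sum>a\<in>letters m. dlog_coeff a i * X (a # w))"
proof -
  have "(\<Sum>a\<in>letters l. dlog_coeff a i * X (a # w)) = (\<Sum>a\<in>letters m. dlog_coeff a i * X (a # w))"
    by (rule sum.mono_neutral_right) (use letters_mono[OF assms(2)] V_outside[OF assms(1)] in auto)
  then show ?thesis by (simp add: nabla_def)
qed

lemma nabla_last:
  assumes "X \<in> V (Suc m)" "m < l"
  shows "nabla l m X w = rdiff m (X w) + (\<Sum>x<m + 2. X (fib m x # w) * inverse (tv m - pt x))"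
proof -
  have "(\<Sum>a\<in>letters m. dlog_coeff a m * X (a # w)) = 0" by (simp add: dlog_coeff_eq_0)
  moreover have "(\<Sum>x<m + 2. dlog_coeff (fib m x) m * X (fib m x # w)) = (\<Sum>x<m + 2. X (fib m x # w) * inverse (tv m - pt x))"
    by (intro sum.cong) (simp_all add: dlog_coeff_fib_last)
  moreover have "nabla l m X w = rdiff m (X w) + (\<Sum>a\<in>letters (Suc m). dlog_coeff a m * X (a # w))"
    by (rule nabla_reduce) (use assms in simp_all)
  ultimately show ?thesis unfolding sum_H_Suc by (simp only: add_0_left)
qed

lemma nabla_W:
  assumes "X \<in> W m" "m \<le> l"
  shows "nabla l i X \<in> W m"
proof -
  have "nabla l i X = (\<lambda>w. rdiff i (X w) + (\<Sum>a\<in>letters m. dlog_coeff a i * X (a # w)))"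
    using nabla_reduce[OF W_V[OF assms(1)] assms(2)] by (simp add: fun_eq_iff)
  then show ?thesis using assms(1)
    by (simp only:) (intro W_add W_rdiff W_sum W_scale W_tail dlog_coeff_in_O)
qed

lemma nabla_eq_0:
  assumes "X \<in> W m" "m \<le> l" "m \<le> i"
  shows "nabla l i X w = 0"
  unfolding nabla_reduce[OF W_V[OF assms(1)] assms(2)]
  using rdiff_O_eq_0[OF W_O[OF assms(1)] assms(3)] assms(3) by (simp add: dlog_coeff_eq_0)

text \<open>The curvature has a part from the derivatives of the logarithmic forms, zero because
  they are closed, and a quadratic part, zero because \<open>X\<close> is integrable.\<close>

lemma nabla_commute:
  assumes "X \<in> V l"
  shows "nabla l i (nabla l k X) w = nabla l k (nabla l i X) w"
proof -
  have *: "nabla l i (nabla l k X) w = rdiff i (rdiff k (X w)) + (\<Sum>a\<in>letters l. rdiff i (dlog_coeff a k) * X (a # w))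
    + (\<Sum>a\<in>letters l. dlog_coeff a k * rdiff i (X (a # w)) + dlog_coeff a i * rdiff k (X (a # w))) + base_nabla l i (base_nabla l k X) w" for i k
    unfolding nabla_def rdiff.add rdiff.sum rdiff.mult base_nabla_def distrib_left sum.distrib
    by (simp only: add_ac)
  have "relations l (\<lambda>a b. X ([] @ [a, b] @ w))" using assms by (simp only: V_def mem_Collect_eq)
  then have "(\<Sum>a\<in>letters l. \<Sum>b\<in>letters l. X (a # b # w) * wedge_coeff k i a b) = 0"
    by (intro relations_imp_integrable) simp
  then have "base_nabla l i (base_nabla l k X) w = base_nabla l k (base_nabla l i X) w"
    using base_nabla_commutator[of l i k X w] by simp
  then show ?thesis unfolding *[of i k] *[of k i]
    by (simp only: rdiff_commute[of i k] rdiff_q_commute[of i _ k] add.commute)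
qed

text \<open>Integration by parts: with \<open>f\<close> equal to the derivative of \<open>g\<close>
  plus simple poles, \<open>g * c\<close> settles the derivative up to terms with tails of
  \<open>c\<close>, which the induction on the length removes. The families \<open>E x\<close>
  settle the poles.\<close>

lemma nabla_surj_pure:
  assumes "c \<in> pure (Suc m) n" "f \<in> O_ring (Suc m)" "m < l"
  shows "\<exists>X\<in>W (Suc m). \<forall>w. nabla l m X w = f * c w"
  using assms(1,2)
proof (induction n arbitrary: f c)
  have main: "\<exists>X\<in>W (Suc m). \<forall>w. nabla l m X w = f * c w"
    if c: "c \<in> pure (Suc m) n" and f: "f \<in> O_ring (Suc m)"
      and R: "\<And>x g. x < m + 2 \<Longrightarrow> g \<in> O_ring (Suc m) \<Longrightarrow>
        \<exists>X\<in>W (Suc m). \<forall>w. nabla l m X w = g * c (fib m x # w)"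
    for n f c
  proof -
    let ?u = "\<lambda>x. inverse (tv m - pt x)"
    obtain g A where g: "g \<in> O_ring (Suc m)" and A: "\<And>x. A x \<in> O_ring m"
      and f_eq: "f = rdiff m g + (\<Sum>x<m + 2. A x * ?u x)"
      using O_Suc_primitive[OF f] by blast
    have c0: "rdiff m (c w) = 0" for w using c by (intro rdiff_rat_const) (simp add: pure_def)
    have gc: "nabla l m (\<lambda>w. g * c w) w = rdiff m g * c w + (\<Sum>x<m + 2. (g * ?u x) * c (fib m x # w))" for w
      using nabla_last[OF V_scale assms(3), of c g w] c
      by (simp add: pure_def rdiff.mult c0 mult_ac del: sum.lessThan_Suc)
    \<comment> \<open>Only \<open>fib m x\<close> may lead to \<open>c\<close>, so the connection in
      direction \<open>t\<^sub>m\<close> sends \<open>E x\<close> to \<open>c\<close> times the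
      simple pole at \<open>pt x\<close>.\<close>
    have "\<exists>E\<in>pure (Suc m) (Suc n). \<forall>y<m + 2. \<forall>w. E (fib m y # w) = (if y = x then c w else 0)" for x
      using fibre_extension[of m "\<lambda>y w. if y = x then c w else 0" n] pure_if[of _ c "Suc m" n] c by blast
    then obtain E where E: "\<And>x. E x \<in> pure (Suc m) (Suc n)"
      "\<And>x y w. y < m + 2 \<Longrightarrow> E x (fib m y # w) = (if y = x then c w else 0)" by metis
    have AE: "nabla l m (\<lambda>w. A x * E x w) w = A x * ?u x * c w" if x: "x < m + 2" for x w
    proof -
      have Eq: "E x \<in> V (Suc m)" "E x w \<in> rat_const" using E(1)[of x] by (simp_all add: pure_def)
      have "rdiff m (A x) = 0" using A rdiff_O_eq_0 by blast
      then have "nabla l m (\<lambda>w. A x * E x w) w = A x * nabla l m (E x) w"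
        by (rule nabla_scale)
      also have "nabla l m (E x) w = (\<Sum>y<m + 2. if y = x then ?u x * c w else 0)"
        unfolding nabla_last[OF Eq(1) assms(3)] rdiff_rat_const[OF Eq(2)] add_0_left
        by (intro sum.cong) (simp_all add: E(2))
      also have "\<dots> = ?u x * c w" using x by simp
      finally show ?thesis by (simp only: mult.assoc)
    qed
    have "\<forall>x\<in>{..<m + 2}. \<exists>X\<in>W (Suc m). \<forall>w. nabla l m X w = (g * ?u x) * c (fib m x # w)"
      using R O_inverse_tv g by (intro ballI R regular.mult) simp_all
    then obtain Z where Z: "\<And>x. x < m + 2 \<Longrightarrow> Z x \<in> W (Suc m)"
      "\<And>x w. x < m + 2 \<Longrightarrow> nabla l m (Z x) w = (g * ?u x) * c (fib m x # w)"
      unfolding bchoice_iff[where 'b = family] Bex_def by (metis lessThan_iff)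
    define X where "X w = (g * c w + (\<Sum>x<m + 2. A x * E x w)) - (\<Sum>x<m + 2. Z x w)" for w
    have "X \<in> W (Suc m)"
      unfolding X_def[abs_def] using g A O_mono[of m "Suc m"] pure_W[OF c] pure_W[OF E(1)] Z(1)
      by (intro W_diff W_add W_sum W_scale) simp_all
    moreover have "nabla l m X w = f * c w" for w
    proof -
      have "nabla l m X w = rdiff m g * c w + (\<Sum>x<m + 2. (g * ?u x) * c (fib m x # w))
          + (\<Sum>x<m + 2. A x * ?u x * c w) - (\<Sum>x<m + 2. (g * ?u x) * c (fib m x # w))"
        unfolding X_def[abs_def] nabla_diff nabla_add nabla_sum gc
        by (intro arg_cong2[of _ _ _ _ "(-)"] arg_cong2[of _ _ _ _ "(+)"] sum.cong refl)
           (simp_all add: AE Z(2))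
      also have "\<dots> = f * c w"
        unfolding f_eq distrib_right sum_distrib_right by simp
      finally show ?thesis .
    qed
    ultimately show ?thesis by blast
  qed
  {
    case 0
    have "c (b # w) = 0" for b w using 0(1) by (simp add: pure_def)
    moreover have "\<exists>X\<in>W (Suc m). \<forall>w. nabla l m X w = 0" using W_0 nabla_0 by blast
    ultimately show ?case by (intro main[OF 0]) simp
  next
    case (Suc n)
    then show ?case by (intro main[OF Suc.prems] Suc.IH pure_tail)
  }
qed

section \<open>Reduction to rational coefficients; surjectivity and kernel along the fibre\<close>

interpretation ratvec: vector_space "\<lambda>(c::rat) f. rconst c * (f :: rat ratfun)"
  by unfold_locales (simp_all only: distrib_left rconst_add distrib_right rconst_mult mult.assoc rconst_1 mult_1_left)

lemma relations_coeff_lincomb: "relations_coeff m x a (\<lambda>c d. \<Sum>b\<in>B. b * C b c d) = (\<Sum>b\<in>B. b * relations_coeff m x a (C b))"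
proof (induction B rule: infinite_finite_induct)
  case (insert b B)
  then show ?case by (simp add: relations_coeff_add relations_coeff_scale)
qed (simp_all add: relations_coeff_def cong: if_cong)

lemma finite_range_W:
  assumes "X \<in> W l"
  shows "finite (range X)"
proof -
  obtain N where N: "\<forall>w. N < length w \<longrightarrow> X w = 0" using assms W_bound by meson
  have "X w \<in> insert 0 (X ` {w. set w \<subseteq> letters l \<and> length w \<le> N})" for w
    using N V_outside[OF W_V[OF assms]] by (cases "set w \<subseteq> letters l \<and> length w \<le> N") auto
  then have "range X \<subseteq> insert 0 (X ` {w. set w \<subseteq> letters l \<and> length w \<le> N})" by blast
  moreover have "finite {w. set w \<subseteq> letters l \<and> length w \<le> N}" by (rule finite_lists_length_le) simp
  ultimately show ?thesis by (meson finite_imageI finite_insert finite_subset)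
qed

text \<open>The relations defining \<open>V\<close> are rational, so they pass to the coefficients of a family with
  respect to a basis of the rational span of its values.\<close>

lemma W_decompose:
  assumes X: "X \<in> W l"
  shows "\<exists>B N c. finite B \<and> B \<subseteq> O_ring l \<and> (\<forall>b\<in>B. \<forall>n. c b n \<in> pure l n) \<and>
    (\<forall>w. X w = (\<Sum>b\<in>B. \<Sum>n\<le>N. b * c b n w))"
proof -
  obtain N where N: "\<forall>w. N < length w \<longrightarrow> X w = 0" using X W_bound by meson
  \<comment> \<open>The basis is taken among the values of \<open>X\<close>, which makes it finite
    and places it in \<open>O_ring l\<close>.\<close>
  obtain B where B: "B \<subseteq> range X" "ratvec.independent B" "range X \<subseteq> ratvec.span B"
    by (rule ratvec.maximal_independent_subset)
  have fB: "finite B" using B(1) finite_range_W[OF X] finite_subset by blast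
  define C where "C b w = rconst (ratvec.representation B (X w) b)" for b w
  have XC: "X w = (\<Sum>b\<in>B. b * C b w)" for w
  proof -
    have "X w \<in> ratvec.span B" using B(3) by blast
    from ratvec.sum_representation_eq[OF B(2) this fB order.refl, symmetric] show ?thesis
      by (rule trans) (intro sum.cong refl, simp only: C_def mult.commute)
  qed
  have C0: "C b w = 0" if "X w = 0" for b w using that by (simp add: C_def ratvec.representation_zero)
  have CQ: "C b w \<in> rat_const" for b w unfolding C_def by (rule rat_const_rconst)
  have C_relations: "relations_coeff m x a (\<lambda>c d. C b (u @ [c, d] @ v)) = 0"
    if "m < l" "x < m + 2" "a \<in> letters m" "b \<in> B" for m x a b u v
  proof -
    let ?r = "\<lambda>b. relations_coeff m x a (\<lambda>c d. C b (u @ [c, d] @ v))"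
    have "?r b \<in> rat_const" for b
      unfolding relations_coeff_def by (intro rat_const_add rat_const_diff rat_const_sum CQ) (auto intro: rat_const_diff CQ)
    then have "\<forall>b. \<exists>s. ?r b = rconst s" unfolding rat_const_def by blast
    then obtain s where s: "\<And>b. ?r b = rconst (s b)" by metis
    have "relations l (\<lambda>c d. X (u @ [c, d] @ v))" using W_V[OF X] by (simp only: V_def mem_Collect_eq)
    then have "relations_coeff m x a (\<lambda>c d. X (u @ [c, d] @ v)) = 0" using that by (simp add: relations_def)
    then have "(\<Sum>b\<in>B. b * ?r b) = 0" unfolding XC relations_coeff_lincomb .
    then have "(\<Sum>b\<in>B. rconst (s b) * b) = 0" unfolding s by (simp only: mult.commute)
    then have "s b = 0" using ratvec.independentD[OF B(2) fB order.refl] that(4) by blast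
    then show ?thesis using s by simp
  qed
  define c where "c b n w = (if length w = n then C b w else 0)" for b n w
  have "c b n \<in> pure l n" if b: "b \<in> B" for b n
  proof -
    have "relations l (\<lambda>d e. c b n (u @ [d, e] @ v))" for u v
    proof (cases "length u + 2 + length v = n")
      case True
      then have "(\<lambda>d e. c b n (u @ [d, e] @ v)) = (\<lambda>d e. C b (u @ [d, e] @ v))" by (simp add: c_def fun_eq_iff)
      then show ?thesis using C_relations b by (simp only: relations_def) simp
    next
      case False
      then have "(\<lambda>d e. c b n (u @ [d, e] @ v)) = (\<lambda>d e. 0)" by (auto simp: c_def fun_eq_iff)
      then show ?thesis using relations_0 by (simp only:)
    qed
    moreover have "c b n w = 0" if "\<not> set w \<subseteq> letters l" for w
      using C0 V_outside[OF W_V[OF X] that] by (simp add: c_def)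
    ultimately show ?thesis using CQ unfolding pure_def V_def by (simp add: c_def)
  qed
  moreover have "X w = (\<Sum>b\<in>B. \<Sum>n\<le>N. b * c b n w)" for w
  proof (cases "length w \<le> N")
    case True
    have "(\<Sum>n\<le>N. b * c b n w) = (\<Sum>n\<le>N. if n = length w then b * C b w else 0)" for b
      by (intro sum.cong) (auto simp: c_def)
    then show ?thesis unfolding XC[of w] using True by simp
  next
    case False
    then have "c b n w = 0" for b n using N C0 by (simp add: c_def)
    then show ?thesis using False N by simp
  qed
  moreover have "B \<subseteq> O_ring l" using B(1) W_O[OF X] by blast
  ultimately show ?thesis using fB by blast
qed

lemma nabla_surj:
  assumes "Y \<in> W (Suc m)" "m < l"
  shows "\<exists>X\<in>W (Suc m). nabla l m X = Y"
proof -
  obtain B N c where B: "finite B" "B \<subseteq> O_ring (Suc m)" "\<And>b n. b \<in> B \<Longrightarrow> c b n \<in> pure (Suc m) n"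
    and Y: "\<And>w. Y w = (\<Sum>b\<in>B. \<Sum>n\<le>N. b * c b n w)"
    using W_decompose[OF assms(1)] by blast
  have "\<forall>b\<in>B. \<forall>n. \<exists>X\<in>W (Suc m). \<forall>w. nabla l m X w = b * c b n w"
    using nabla_surj_pure[OF B(3) _ assms(2)] B(2) by blast
  then obtain Z where Z: "\<And>b n. b \<in> B \<Longrightarrow> Z b n \<in> W (Suc m)"
    "\<And>b n w. b \<in> B \<Longrightarrow> nabla l m (Z b n) w = b * c b n w"
    by metis
  have "nabla l m (\<lambda>w. \<Sum>b\<in>B. \<Sum>n\<le>N. Z b n w) w = Y w" for w
    unfolding nabla_sum Y by (intro sum.cong refl Z(2))
  moreover have "(\<lambda>w. \<Sum>b\<in>B. \<Sum>n\<le>N. Z b n w) \<in> W (Suc m)" by (intro W_sum Z(1))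
  ultimately show ?thesis by blast
qed

text \<open>Longest words come first: once the values on longer words are constant along the fibre,
  they are residues in the equation at \<open>w\<close>, so they vanish if a fibre letter was added,
  and \<open>X w\<close> comes from the base. Then \<open>V_vanish\<close> removes all fibre
  letters.\<close>

lemma nabla_kernel:
  assumes X: "X \<in> W (Suc m)" and "m < l" and 0: "\<And>w. nabla l m X w = 0"
  shows "X \<in> W m"
proof -
  obtain N where N: "\<forall>w. N < length w \<longrightarrow> X w = 0" using X W_bound by meson
  have *: "X w \<in> O_ring m \<and> (\<forall>x<m + 2. X (fib m x # w) = 0)" for w
  \<comment> \<open>The measure is 0 exactly for the words beyond the bound \<open>N\<close>, on
    which \<open>X\<close> is zero.\<close>
  proof (induction "Suc N - length w" arbitrary: w rule: less_induct)
    case less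
    show ?case
    proof (cases "N < length w")
      case False
      have "rdiff m (X (fib m x # w)) = 0" if "x < m + 2" for x
        using less[of "fib m x # w"] False by (intro rdiff_O_eq_0[of _ m]) auto
      moreover have "rdiff m (X w) + (\<Sum>x<m + 2. X (fib m x # w) * inverse (tv m - pt x)) = 0"
        using 0[of w] unfolding nabla_last[OF W_V[OF X] assms(2)] .
      ultimately show ?thesis using O_Suc_closed[OF W_O[OF X, of w], of "\<lambda>x. X (fib m x # w)"] by blast
    qed (use N in simp)
  qed
  have out: "X w = 0" if "\<not> set w \<subseteq> letters m" for w
    by (rule V_vanish[OF W_V[OF X] _ that]) (use * in blast)
  have "relations m (\<lambda>a b. X (u @ [a, b] @ v))" for u v
  proof -
    have "relations (Suc m) (\<lambda>a b. X (u @ [a, b] @ v))" using W_V[OF X] by (simp only: V_def mem_Collect_eq)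
    then show ?thesis by (simp only: relations_Suc)
  qed
  then have "X \<in> V m" using out by (simp add: V_def)
  then show ?thesis using * N unfolding W_def by blast
qed

section \<open>The Koszul complex of the connection\<close>

lemma V_Suc:
  assumes X: "X \<in> V m"
  shows "X \<in> V (Suc m)"
proof -
  have A: "X (u @ [fib m x, b] @ v) = 0" "X (u @ [b, fib m x] @ v) = 0" for u v b x
    using fib_notin_H[of m m x] by (intro V_outside[OF X]; simp)+
  have "relations_coeff m x a (\<lambda>a b. X (u @ [a, b] @ v)) = 0" for u v x a
    unfolding relations_coeff_def A by (simp only: diff_self if_cancel sum.neutral_const add_0_left)
  moreover have "X w = 0" if "\<not> set w \<subseteq> letters (Suc m)" for w
    using that by (intro V_outside[OF X]) (auto simp: letters_Suc)
  moreover have "relations m (\<lambda>a b. X (u @ [a, b] @ v))" for u v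
    using X by (simp only: V_def mem_Collect_eq)
  ultimately show ?thesis unfolding V_def relations_Suc by blast
qed

lemma W_mono: "m \<le> n \<Longrightarrow> W m \<subseteq> W n"
proof (induction rule: dec_induct)
  case (step n)
  have "X \<in> W (Suc n)" if "X \<in> W n" for X
    using that V_Suc[of X n] O_mono[of n "Suc n"] unfolding W_def by auto
  then show ?case using step by blast
qed simp

text \<open>For \<open>i\<close> in \<open>I\<close> this is the sign in
  \<open>dt\<^sub>i \<and> J = ins_sign i I * dt\<^sub>I\<close>, where \<open>J\<close> stands for
  the basis form of \<open>I - {i}\<close>.\<close>

definition ins_sign :: "nat \<Rightarrow> nat set \<Rightarrow> rat ratfun" where
  "ins_sign i I = shuffle_sign {i} (I - {i})"

lemma ins_sign_eq: "ins_sign i I = (- 1) ^ card {b \<in> I. b < i}"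
proof -
  have "{(a, b). a \<in> {i} \<and> b \<in> I - {i} \<and> b < a} = Pair i ` {b \<in> I. b < i}" by auto
  then show ?thesis by (simp add: ins_sign_def shuffle_sign_def card_image inj_on_def)
qed

lemma ins_sign_square: "ins_sign i I * ins_sign i I = 1"
  unfolding ins_sign_eq by (simp flip: power_add mult_2)

lemma rdiff_sg: "rdiff k (ins_sign i I) = 0"
proof -
  have "rdiff k ((- 1 :: rat ratfun) ^ n) = 0" for n
    by (induction n) (simp_all add: rdiff.mult rdiff.uminus)
  then show ?thesis by (simp add: ins_sign_eq)
qed

lemma ins_sign_in_O: "ins_sign i I \<in> O_ring l"
  unfolding ins_sign_eq by (intro O_power O_uminus O_1)

lemma ins_sign_exchange_less:
  assumes "finite I" "i \<in> I" "k \<in> I" "i < k"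
  shows "ins_sign i I * ins_sign k (I - {i}) = - (ins_sign k I * ins_sign i (I - {k}))"
proof -
  have "{b \<in> I - {k}. b < i} = {b \<in> I. b < i}" using assms by auto
  then have 1: "ins_sign i (I - {k}) = ins_sign i I" by (simp add: ins_sign_eq)
  have "{b \<in> I. b < k} = insert i {b \<in> I - {i}. b < k}" using assms by auto
  then have "card {b \<in> I. b < k} = Suc (card {b \<in> I - {i}. b < k})" using assms by simp
  then have 2: "ins_sign k I = - ins_sign k (I - {i})" by (simp add: ins_sign_eq)
  show ?thesis unfolding 1 2 by (simp add: mult.commute)
qed

lemma ins_sign_exchange:
  assumes "finite I" "i \<in> I" "k \<in> I" "i \<noteq> k"
  shows "ins_sign i I * ins_sign k (I - {i}) = - (ins_sign k I * ins_sign i (I - {k}))"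
  using ins_sign_exchange_less[of I i k] ins_sign_exchange_less[of I k i] assms by (cases i k rule: linorder_cases) auto

text \<open>A cochain of degree \<open>j\<close> is the family of coefficients of a form \<open>\<Sum> \<Phi> I dt\<^sub>I\<close>, \<open>card I = j\<close>.\<close>

definition cochains :: "nat \<Rightarrow> nat \<Rightarrow> (nat set \<Rightarrow> family) set" where
  "cochains m j = {\<Phi>. \<forall>I. \<Phi> I \<in> W m \<and> (\<Phi> I \<noteq> (\<lambda>w. 0) \<longrightarrow> I \<subseteq> {..<m} \<and> card I = j)}"

definition koszul_d :: "nat \<Rightarrow> (nat set \<Rightarrow> family) \<Rightarrow> nat set \<Rightarrow> family" where
  "koszul_d l \<Phi> I w = (\<Sum>i\<in>I. ins_sign i I * nabla l i (\<Phi> (I - {i})) w)"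

lemma cochains_W: "\<Phi> \<in> cochains m j \<Longrightarrow> \<Phi> I \<in> W m"
  by (simp add: cochains_def)

lemma cochains_eq_0: "\<Phi> \<in> cochains m j \<Longrightarrow> \<not> (I \<subseteq> {..<m} \<and> card I = j) \<Longrightarrow> \<Phi> I = (\<lambda>w. 0)"
  unfolding cochains_def by blast

lemma cochainsI:
  assumes "\<And>I. I \<subseteq> {..<m} \<Longrightarrow> card I = j \<Longrightarrow> \<Phi> I \<in> W m"
    and "\<And>I. \<not> (I \<subseteq> {..<m} \<and> card I = j) \<Longrightarrow> \<Phi> I = (\<lambda>w. 0)"
  shows "\<Phi> \<in> cochains m j"
  unfolding cochains_def using assms W_0[of m] by (auto, metis)

lemma koszul_d_add: "koszul_d l (\<lambda>I w. \<Phi> I w + \<Psi> I w) I w = koszul_d l \<Phi> I w + koszul_d l \<Psi> I w"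
  by (simp add: koszul_d_def nabla_add distrib_left sum.distrib)

lemma koszul_d_diff: "koszul_d l (\<lambda>I w. \<Phi> I w - \<Psi> I w) I w = koszul_d l \<Phi> I w - koszul_d l \<Psi> I w"
  by (simp add: koszul_d_def nabla_diff right_diff_distrib sum_subtractf)

lemma koszul_d_cochains:
  assumes \<Phi>: "\<Phi> \<in> cochains m j" and "m \<le> l"
  shows "koszul_d l \<Phi> \<in> cochains m (Suc j)"
proof (rule cochainsI)
  show "koszul_d l \<Phi> I \<in> W m" for I
    unfolding koszul_d_def[abs_def] using cochains_W[OF \<Phi>] assms(2) ins_sign_in_O
    by (intro W_sum W_scale nabla_W)
  fix I assume I: "\<not> (I \<subseteq> {..<m} \<and> card I = Suc j)"
  have "nabla l i (\<Phi> (I - {i})) w = 0" if "finite I" "i \<in> I" for i w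
  proof (cases "I - {i} \<subseteq> {..<m} \<and> card (I - {i}) = j")
    case True
    then have "card I = Suc j" using that by (metis card_Suc_Diff1)
    then have "m \<le> i" using I True that by (auto simp: subset_iff not_less)
    then show ?thesis using nabla_eq_0 cochains_W[OF \<Phi>] assms(2) by blast
  next
    case False
    then show ?thesis using cochains_eq_0[OF \<Phi>] by simp
  qed
  then show "koszul_d l \<Phi> I = (\<lambda>w. 0)"
    unfolding koszul_d_def[abs_def] by (cases "finite I") simp_all
qed

text \<open>The operators commute while the signs of the two orders of removing \<open>i\<close> and
  \<open>k\<close> are opposite. Setting \<open>T i i = 0\<close> lets both sums run over
  \<open>I\<close>.\<close>

lemma koszul_d_dd:
  assumes \<Phi>: "\<And>I. \<Phi> I \<in> V l"
  shows "koszul_d l (koszul_d l \<Phi>) I w = 0"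
proof (cases "finite I")
  case True
  define T where "T i k = (if i = k then 0 else ins_sign i I * ins_sign k (I - {i}) * nabla l i (nabla l k (\<Phi> (I - {i} - {k}))) w)" for i k
  have "ins_sign i I * nabla l i (koszul_d l \<Phi> (I - {i})) w = (\<Sum>k\<in>I. T i k)" if "i \<in> I" for i
  proof -
    have "ins_sign i I * nabla l i (koszul_d l \<Phi> (I - {i})) w = (\<Sum>k\<in>I - {i}. T i k)"
      unfolding koszul_d_def[abs_def] nabla_sum sum_distrib_left
      by (intro sum.cong) (auto simp: T_def nabla_scale rdiff_sg)
    also have "\<dots> = (\<Sum>k\<in>I. T i k)"
      by (rule sum.mono_neutral_left) (use True in \<open>auto simp: T_def\<close>)
    finally show ?thesis .
  qed
  then have S: "koszul_d l (koszul_d l \<Phi>) I w = (\<Sum>i\<in>I. \<Sum>k\<in>I. T i k)"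
    unfolding koszul_d_def[of l "koszul_d l \<Phi>"] by (rule sum.cong[OF refl])
  have T: "T k i = - T i k" if "i \<in> I" "k \<in> I" for i k
  proof (cases "i = k")
    case False
    have "I - {k} - {i} = I - {i} - {k}" by blast
    then show ?thesis using False ins_sign_exchange[OF True that False] nabla_commute[OF \<Phi>, of i k _ w]
      by (simp add: T_def)
  qed (simp add: T_def)
  have "(\<Sum>i\<in>I. \<Sum>k\<in>I. T i k) = (\<Sum>i\<in>I. \<Sum>k\<in>I. T k i)" by (rule sum.swap)
  also have "\<dots> = - (\<Sum>i\<in>I. \<Sum>k\<in>I. T i k)" unfolding sum_negf[symmetric] by (intro sum.cong refl T)
  finally have "(\<Sum>i\<in>I. \<Sum>k\<in>I. T i k) = 0" by (simp add: equal_neg_zero)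
  then show ?thesis using S by simp
qed (simp add: koszul_d_def)

text \<open>Along the fibre coordinate \<open>t\<^sub>m\<close> the operator \<open>nabla l m\<close> is onto with kernel \<open>W m\<close>, so the
  part of a cocycle that contains \<open>dt\<^sub>m\<close> can be removed, and what is left lives on the base.\<close>

lemma koszul_d_exact:
  assumes "\<Phi> \<in> cochains m (Suc j)" "m \<le> l" "\<And>I w. I \<subseteq> {..<m} \<Longrightarrow> koszul_d l \<Phi> I w = 0"
  shows "\<exists>\<Psi>\<in>cochains m j. koszul_d l \<Psi> = \<Phi>"
  using assms
\<comment> \<open>The ambient \<open>l\<close> stays fixed, so the remainder on the base is a
  cocycle for the very same differential.\<close>
proof (induction m arbitrary: \<Phi>)
  case 0
  have "\<Phi> I = (\<lambda>w. 0)" for I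
    by (rule cochains_eq_0[OF 0(1)]) auto
  then have "koszul_d l (\<lambda>I w. 0) = \<Phi>" by (simp add: koszul_d_def fun_eq_iff)
  moreover have "(\<lambda>I w. 0) \<in> cochains 0 j" by (simp add: cochains_def W_0)
  ultimately show ?case by blast
next
  case (Suc m)
  note \<Phi> = Suc.prems(1) and ml = Suc.prems(2)
  \<comment> \<open>The sign is its own inverse: with it, the differential of \<open>\<Psi>1\<close>
    has exactly the coefficients of \<open>\<Phi>\<close> on sets that contain
    \<open>m\<close>.\<close>
  have "\<exists>X\<in>W (Suc m). nabla l m X = (\<lambda>w. ins_sign m (insert m J) * \<Phi> (insert m J) w)" for J
    using ml by (intro nabla_surj W_scale cochains_W[OF \<Phi>] ins_sign_in_O) simp
  then obtain Z where Z: "\<And>J. Z J \<in> W (Suc m)"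
    "\<And>J w. nabla l m (Z J) w = ins_sign m (insert m J) * \<Phi> (insert m J) w" by metis
  define \<Psi>1 where "\<Psi>1 J = (if J \<subseteq> {..<m} \<and> card J = j then Z J else (\<lambda>w. 0))" for J
  have \<Psi>1: "\<Psi>1 \<in> cochains (Suc m) j"
    by (rule cochainsI) (auto simp: \<Psi>1_def Z(1) W_0 less_Suc_eq subset_iff)
  have \<Psi>1_m: "\<Psi>1 J = (\<lambda>w. 0)" if "m \<in> J" for J using that by (auto simp: \<Psi>1_def)
  define \<alpha> where "\<alpha> I w = \<Phi> I w - koszul_d l \<Psi>1 I w" for I w
  have d\<Psi>1: "koszul_d l \<Psi>1 \<in> cochains (Suc m) (Suc j)" by (rule koszul_d_cochains[OF \<Psi>1 ml])
  have \<alpha>: "\<alpha> \<in> cochains (Suc m) (Suc j)"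
  proof (rule cochainsI)
    show "\<alpha> I \<in> W (Suc m)" for I
      unfolding \<alpha>_def[abs_def] using cochains_W[OF \<Phi>] cochains_W[OF d\<Psi>1] by (rule W_diff)
    show "\<alpha> I = (\<lambda>w. 0)" if "\<not> (I \<subseteq> {..<Suc m} \<and> card I = Suc j)" for I
      unfolding \<alpha>_def[abs_def] using cochains_eq_0[OF \<Phi> that] cochains_eq_0[OF d\<Psi>1 that] by simp
  qed
  have fin: "finite J" if "J \<subseteq> {..<m}" for J using that finite_subset by blast
  have koszul_d_insert: "koszul_d l \<Theta> (insert m J) w = ins_sign m (insert m J) * nabla l m (\<Theta> J) w"
    if J: "J \<subseteq> {..<m}" and \<Theta>: "\<And>I. m \<in> I \<Longrightarrow> I \<subseteq> {..<Suc m} \<Longrightarrow> \<Theta> I = (\<lambda>w. 0)" for \<Theta> J w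
  proof -
    have mJ: "m \<notin> J" using J by auto
    have "(\<Sum>i\<in>J. ins_sign i (insert m J) * nabla l i (\<Theta> (insert m J - {i})) w) = 0"
    proof (rule sum.neutral, rule ballI)
      fix i assume "i \<in> J"
      then have "m \<in> insert m J - {i}" "insert m J - {i} \<subseteq> {..<Suc m}" using mJ J by auto
      then show "ins_sign i (insert m J) * nabla l i (\<Theta> (insert m J - {i})) w = 0"
        using \<Theta> by simp
    qed
    then show ?thesis unfolding koszul_d_def using mJ fin[OF J] by simp
  qed
  have \<alpha>_m: "\<alpha> I = (\<lambda>w. 0)" if "m \<in> I" "I \<subseteq> {..<Suc m}" for I
  proof (cases "card I = Suc j")
    case True
    define J where "J = I - {m}"
    have J: "J \<subseteq> {..<m}" "I = insert m J" using that by (auto simp: J_def less_Suc_eq)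
    have "finite I" using that(2) finite_subset by blast
    then have "card J = j" using True that(1) by (simp add: J_def)
    have "\<alpha> I w = 0" for w
    proof -
      have "koszul_d l \<Psi>1 I w = ins_sign m I * nabla l m (\<Psi>1 J) w"
        unfolding J(2) by (rule koszul_d_insert[OF J(1) \<Psi>1_m])
      also have "\<dots> = (ins_sign m I * ins_sign m I) * \<Phi> I w"
        using J \<open>card J = j\<close> Z(2)[of J w] by (simp add: \<Psi>1_def mult.assoc)
      finally show ?thesis by (simp add: \<alpha>_def ins_sign_square)
    qed
    then show ?thesis by (simp add: fun_eq_iff)
  next
    case False
    then show ?thesis using cochains_eq_0[OF \<alpha>] by simp
  qed
  have d\<alpha>: "koszul_d l \<alpha> I w = 0" if "I \<subseteq> {..<Suc m}" for I w
  proof -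
    have "\<Psi>1 I \<in> V l" for I
    proof -
      have "W (Suc m) \<subseteq> W l" using ml by (rule W_mono)
      then show ?thesis using cochains_W[OF \<Psi>1] W_V by blast
    qed
    then have "koszul_d l (koszul_d l \<Psi>1) I w = 0" by (rule koszul_d_dd)
    then show ?thesis unfolding \<alpha>_def[abs_def] koszul_d_diff using Suc.prems(3)[OF that] by simp
  qed
  \<comment> \<open>As \<open>\<alpha>\<close> has no part with \<open>dt\<^sub>m\<close>, such a
    part of its differential can only come from \<open>nabla l m\<close>. It is zero, so
    \<open>\<alpha> J\<close> lies in the kernel.\<close>
  have \<alpha>W: "\<alpha> J \<in> W m" if J: "J \<subseteq> {..<m}" for J
  proof (rule nabla_kernel[OF cochains_W[OF \<alpha>]])
    show "m < l" using ml by simp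
    fix w
    have "insert m J \<subseteq> {..<Suc m}" using J by auto
    then have "koszul_d l \<alpha> (insert m J) w = 0" by (rule d\<alpha>)
    moreover have "koszul_d l \<alpha> (insert m J) w = ins_sign m (insert m J) * nabla l m (\<alpha> J) w"
      by (rule koszul_d_insert[OF J \<alpha>_m])
    ultimately have "ins_sign m (insert m J) * nabla l m (\<alpha> J) w = 0" by simp
    then show "nabla l m (\<alpha> J) w = 0" using ins_sign_square[of m "insert m J"] by force
  qed
  have \<alpha>m: "\<alpha> \<in> cochains m (Suc j)"
  proof (rule cochainsI)
    show "\<alpha> I \<in> W m" if "I \<subseteq> {..<m}" for I by (rule \<alpha>W[OF that])
    fix I assume I: "\<not> (I \<subseteq> {..<m} \<and> card I = Suc j)"
    show "\<alpha> I = (\<lambda>w. 0)"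
    proof (cases "I \<subseteq> {..<Suc m} \<and> m \<in> I")
      case False
      then have "\<not> (I \<subseteq> {..<Suc m} \<and> card I = Suc j)" using I by (auto simp: less_Suc_eq subset_iff)
      then show ?thesis by (rule cochains_eq_0[OF \<alpha>])
    qed (use \<alpha>_m in blast)
  qed
  have "\<exists>\<Psi>\<in>cochains m j. koszul_d l \<Psi> = \<alpha>"
    using ml d\<alpha> by (intro Suc.IH[OF \<alpha>m]) (auto simp: subset_iff less_Suc_eq)
  then obtain \<Psi>2 where \<Psi>2: "\<Psi>2 \<in> cochains m j" "koszul_d l \<Psi>2 = \<alpha>" by blast
  define \<Psi> where "\<Psi> I w = \<Psi>1 I w + \<Psi>2 I w" for I w
  have "koszul_d l \<Psi> = \<Phi>" unfolding \<Psi>_def[abs_def] by (intro ext) (simp add: koszul_d_add \<Psi>2(2) \<alpha>_def)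
  moreover have "\<Psi> \<in> cochains (Suc m) j"
  proof (rule cochainsI)
    show "\<Psi> I \<in> W (Suc m)" for I
      unfolding \<Psi>_def[abs_def] using cochains_W[OF \<Psi>1] cochains_W[OF \<Psi>2(1)] W_mono[of m "Suc m"]
      by (intro W_add) auto
    fix I assume I: "\<not> (I \<subseteq> {..<Suc m} \<and> card I = j)"
    then have "\<not> (I \<subseteq> {..<m} \<and> card I = j)" by (auto simp: subset_iff)
    then show "\<Psi> I = (\<lambda>w. 0)"
      unfolding \<Psi>_def[abs_def] using cochains_eq_0[OF \<Psi>1 I] cochains_eq_0[OF \<Psi>2(1)] by simp
  qed
  ultimately show ?case by blast
qed

section \<open>The bar complex\<close>

lemma sum_fun_apply: "(\<Sum>x\<in>A. f x) y = (\<Sum>x\<in>A. f x y)"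
  by (induction A rule: infinite_finite_induct) simp_all

lemma hyps_conf: "hyps (conf l) = letters l"
  by (simp add: letters_def)

lemma shuffle_sign_empty [simp]: "shuffle_sign A {} = 1"
  by (simp add: shuffle_sign_def)

lemma omega_singleton: "omega (conf l) a {i} = dlog_coeff a i"
  by (simp add: omega_def dlog_def scale_def ext_d_def fun_form_def dlog_coeff_def divide_inverse mult.commute
      del: inverse_fract)

lemma omega_eq_0: "\<nexists>i. I = {i} \<Longrightarrow> omega (conf l) a I = 0"
proof -
  assume I: "\<nexists>i. I = {i}"
  have "I - {i} \<noteq> {}" if "i \<in> I" for i using I that by blast
  then show ?thesis
    by (simp add: omega_def dlog_def scale_def ext_d_def fun_form_def)
qed

lemma wedge_omega:
  assumes "finite I"
  shows "(\<phi> \<and>\<^sub>f omega (conf l) a) I = (\<Sum>i\<in>I. shuffle_sign (I - {i}) {i} * \<phi> (I - {i}) * dlog_coeff a i)"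
proof -
  let ?g = "\<lambda>A. shuffle_sign A (I - A) * \<phi> A * omega (conf l) a (I - A)"
  have "(\<Sum>A\<in>Pow I. ?g A) = (\<Sum>A\<in>(\<lambda>i. I - {i}) ` I. ?g A)"
  proof (rule sum.mono_neutral_right)
    show "\<forall>A\<in>Pow I - (\<lambda>i. I - {i}) ` I. ?g A = 0"
    proof
      fix A assume A: "A \<in> Pow I - (\<lambda>i. I - {i}) ` I"
      have "\<nexists>i. I - A = {i}"
      proof
        assume "\<exists>i. I - A = {i}"
        then obtain i where "I - A = {i}" by blast
        then have "A = I - {i}" "i \<in> I" using A by auto
        then show False using A by blast
      qed
      then show "?g A = 0" by (simp add: omega_eq_0)
    qed
  qed (use assms in auto)
  also have "\<dots> = (\<Sum>i\<in>I. ?g (I - {i}))"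
    by (subst sum.reindex) (auto simp: inj_on_def)
  also have "\<dots> = (\<Sum>i\<in>I. shuffle_sign (I - {i}) {i} * \<phi> (I - {i}) * dlog_coeff a i)"
  proof (rule sum.cong[OF refl])
    fix i assume "i \<in> I"
    then have "I - (I - {i}) = {i}" by blast
    then show "?g (I - {i}) = shuffle_sign (I - {i}) {i} * \<phi> (I - {i}) * dlog_coeff a i"
      by (simp only: omega_singleton)
  qed
  finally show ?thesis by (simp only: wedge_def)
qed

lemma wedge_infinite: "infinite I \<Longrightarrow> (\<phi> \<and>\<^sub>f \<psi>) I = 0"
  by (simp add: wedge_def)

lemma shuffle_sign_pair: "shuffle_sign {i} {k} = (if k < i then - 1 else 1)"
proof -
  have "{(a, b). a \<in> {i} \<and> b \<in> {k} \<and> b < a} = (if k < i then {(i, k)} else {})" by auto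
  then show ?thesis by (simp add: shuffle_sign_def)
qed

lemma omega_wedge_pair:
  assumes "i < k"
  shows "(omega (conf l) a \<and>\<^sub>f omega (conf l) b) {i, k} = wedge_coeff i k a b"
proof -
  have "{i, k} - {i} = {k}" "{i, k} - {k} = {i}" using assms by auto
  then show ?thesis using assms
    by (simp add: wedge_omega omega_singleton shuffle_sign_pair wedge_coeff_def)
qed

lemma omega_wedge_other:
  assumes "\<And>i k. i < k \<Longrightarrow> I \<noteq> {i, k}"
  shows "(omega (conf l) a \<and>\<^sub>f omega (conf l) b) I = 0"
proof (cases "finite I")
  case True
  have "omega (conf l) a (I - {i}) = 0" if "i \<in> I" for i
  proof (rule omega_eq_0, rule notI)
    assume "\<exists>k. I - {i} = {k}"
    then obtain k where "I - {i} = {k}" by blast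
    then have "I = {i, k}" "i \<noteq> k" using that by auto
    then show False using assms[of i k] assms[of k i] by (metis insert_commute linorder_neqE_nat)
  qed
  then show ?thesis using True by (simp add: wedge_omega)
qed (rule wedge_infinite)

lemma wedge_coeff_antisym: "wedge_coeff i k a b = - wedge_coeff k i a b"
  by (simp add: wedge_coeff_def)

text \<open>The product has coefficients only at two-element sets. Indices \<open>i = k\<close> or
  \<open>i > k\<close> add nothing, by antisymmetry of \<open>wedge_coeff\<close>.\<close>

lemma integrable_iff:
  "(\<Sum>a\<in>letters l. \<Sum>b\<in>letters l. scale (C a b) (omega (conf l) a \<and>\<^sub>f omega (conf l) b)) = 0 \<longleftrightarrow>
     (\<forall>i k. (\<Sum>a\<in>letters l. \<Sum>b\<in>letters l. C a b * wedge_coeff i k a b) = 0)" (is "?F = 0 \<longleftrightarrow> (\<forall>i k. ?S i k = 0)")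
proof -
  have F: "?F I = (\<Sum>a\<in>letters l. \<Sum>b\<in>letters l. C a b * (omega (conf l) a \<and>\<^sub>f omega (conf l) b) I)" for I
    by (simp add: sum_fun_apply scale_def)
  have pair: "?F {i, k} = ?S i k" if "i < k" for i k
    unfolding F omega_wedge_pair[OF that] ..
  have other: "?F I = 0" if "\<And>i k. i < k \<Longrightarrow> I \<noteq> {i, k}" for I
    unfolding F using omega_wedge_other[of I l, OF that] by simp
  show ?thesis
  proof
    assume 0: "?F = 0"
    have pos: "?S i k = 0" if "i < k" for i k using pair[OF that] 0 by simp
    have swap: "?S i k = - ?S k i" for i k
      unfolding sum_negf[symmetric] by (intro sum.cong refl) (subst wedge_coeff_antisym, simp)
    have "?S i k = 0" for i k
    proof (cases i k rule: linorder_cases)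
      case less
      then show ?thesis by (rule pos)
    next
      case equal
      then show ?thesis by (simp add: wedge_coeff_def)
    next
      case greater
      then show ?thesis unfolding swap[of i k] using pos[OF greater] by simp
    qed
    then show "\<forall>i k. ?S i k = 0" by blast
  next
    assume S: "\<forall>i k. ?S i k = 0"
    have "?F I = 0" for I
    proof (cases "\<exists>i k. i < k \<and> I = {i, k}")
      case True
      then obtain i k where "i < k" "I = {i, k}" by blast
      then show ?thesis using pair[of i k] S by simp
    next
      case False
      then show ?thesis by (intro other) blast
    qed
    then show "?F = 0" by (intro ext) simp
  qed
qed

lemma rconst_eq_0_iff: "rconst c = 0 \<longleftrightarrow> c = 0"
  using rconst_eq_iff[of c 0] by (simp only: rconst_0)

lemma bar_words_iff_pure: "c \<in> bar_words (conf l) n \<longleftrightarrow> (\<lambda>w. rconst (c w)) \<in> pure l n"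
proof -
  let ?X = "\<lambda>w. rconst (c w)"
  let ?supp = "\<forall>w. c w \<noteq> 0 \<longrightarrow> length w = n \<and> set w \<subseteq> letters l"
  have "(\<forall>u v. length u + 2 + length v = n \<longrightarrow> (\<forall>i k. (\<Sum>a\<in>letters l. \<Sum>b\<in>letters l. ?X (u @ [a, b] @ v) * wedge_coeff i k a b) = 0)) \<longleftrightarrow>
      (\<forall>u v. relations l (\<lambda>a b. ?X (u @ [a, b] @ v)))" if supp: ?supp
  proof (intro iffI allI impI)
    fix u v
    assume int: "\<forall>u v. length u + 2 + length v = n \<longrightarrow> (\<forall>i k. (\<Sum>a\<in>letters l. \<Sum>b\<in>letters l. ?X (u @ [a, b] @ v) * wedge_coeff i k a b) = 0)"
    show "relations l (\<lambda>a b. ?X (u @ [a, b] @ v))"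
    proof (cases "length u + 2 + length v = n")
      case True
      then show ?thesis using int by (intro integrable_imp_rel rat_const_rconst) blast
    next
      case False
      have "c (u @ [a, b] @ v) = 0" for a b
      proof (rule ccontr)
        assume "c (u @ [a, b] @ v) \<noteq> 0"
        then have "length (u @ [a, b] @ v) = n" using supp by blast
        then show False using False by simp
      qed
      then show ?thesis using relations_0 by (simp only: rconst_0)
    qed
  next
    fix u v i k
    assume "\<forall>u v. relations l (\<lambda>a b. ?X (u @ [a, b] @ v))"
    then show "(\<Sum>a\<in>letters l. \<Sum>b\<in>letters l. ?X (u @ [a, b] @ v) * wedge_coeff i k a b) = 0"
      by (intro relations_imp_integrable) blast
  qed
  then have "c \<in> bar_words (conf l) n \<longleftrightarrow> ?supp \<and> (\<forall>u v. relations l (\<lambda>a b. ?X (u @ [a, b] @ v)))"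
    unfolding bar_words_def hyps_conf integrable_iff mem_Collect_eq by blast
  also have "\<dots> \<longleftrightarrow> ?X \<in> pure l n"
    unfolding pure_def V_def mem_Collect_eq rconst_eq_0_iff using rat_const_rconst by blast
  finally show ?thesis .
qed

lemma pure_imp_bar_words:
  assumes "X \<in> pure l n"
  shows "\<exists>c\<in>bar_words (conf l) n. X = (\<lambda>w. rconst (c w))"
proof -
  have "\<forall>w. \<exists>s. X w = rconst s" using assms unfolding pure_def rat_const_def by blast
  then obtain c where c: "\<And>w. X w = rconst (c w)" by metis
  then have "X = (\<lambda>w. rconst (c w))" by (rule ext)
  then show ?thesis using assms bar_words_iff_pure by blast
qed

section \<open>Comparison of the bar complex with the Koszul complex\<close>

lemma bar_forms_0: "0 \<in> bar_forms M j"
  unfolding bar_forms_def by (intro CollectI exI[of _ 0]) simp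

lemma bar_forms_tens: "\<phi> \<in> forms M j \<Longrightarrow> c \<in> bar_words M n \<Longrightarrow> tens \<phi> c \<in> bar_forms M j"
  unfolding bar_forms_def by (intro CollectI exI[of _ "1::nat"] exI[of _ "\<lambda>_. \<phi>"] exI[of _ "\<lambda>_. c"]) auto

lemma sum_lessThan_add: "(\<Sum>r<M + N. f r) = (\<Sum>r<M. f r) + (\<Sum>r<N. f (M + r))" for f :: "nat \<Rightarrow> 'a::comm_monoid_add"
  by (induction N) (simp_all add: add.assoc)

lemma bar_forms_add:
  assumes "\<Phi> \<in> bar_forms M j" "\<Psi> \<in> bar_forms M j"
  shows "\<Phi> + \<Psi> \<in> bar_forms M j"
proof -
  obtain N1 \<phi>1 c1 where 1: "\<Phi> = (\<Sum>r<N1. tens (\<phi>1 r) (c1 r))"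
    "\<And>r. r < (N1::nat) \<Longrightarrow> \<phi>1 r \<in> forms M j \<and> c1 r \<in> (\<Union>m. bar_words M m)"
    using assms(1) unfolding bar_forms_def by blast
  obtain N2 \<phi>2 c2 where 2: "\<Psi> = (\<Sum>r<N2. tens (\<phi>2 r) (c2 r))"
    "\<And>r. r < (N2::nat) \<Longrightarrow> \<phi>2 r \<in> forms M j \<and> c2 r \<in> (\<Union>m. bar_words M m)"
    using assms(2) unfolding bar_forms_def by blast
  define \<phi> where "\<phi> r = (if r < N1 then \<phi>1 r else \<phi>2 (r - N1))" for r
  define c where "c r = (if r < N1 then c1 r else c2 (r - N1))" for r
  have "\<Phi> + \<Psi> = (\<Sum>r<N1 + N2. tens (\<phi> r) (c r))"
    unfolding 1 2 sum_lessThan_add by (simp add: \<phi>_def c_def)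
  moreover have "\<phi> r \<in> forms M j \<and> c r \<in> (\<Union>m. bar_words M m)" if "r < N1 + N2" for r
    using 1(2)[of r] 2(2)[of "r - N1"] that unfolding \<phi>_def c_def by (cases "r < N1") simp_all
  ultimately show ?thesis unfolding bar_forms_def by blast
qed

lemma bar_forms_sum: "(\<And>x. x \<in> A \<Longrightarrow> \<Phi> x \<in> bar_forms M j) \<Longrightarrow> (\<Sum>x\<in>A. \<Phi> x) \<in> bar_forms M j"
  by (induction A rule: infinite_finite_induct) (simp_all add: bar_forms_0 bar_forms_add)

text \<open>The substance is the passage from cochains to tensors: \<open>W_decompose\<close> splits
  each coefficient into finitely many products of a function and a rational integrable
  family.\<close>

lemma bar_forms_iff: "\<Phi> \<in> bar_forms (conf l) j \<longleftrightarrow> (\<lambda>I w. \<Phi> w I) \<in> cochains l j"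
proof
  assume "\<Phi> \<in> bar_forms (conf l) j"
  then obtain N \<phi> c where \<Phi>: "\<Phi> = (\<Sum>r<N. tens (\<phi> r) (c r))"
    and r: "\<And>r. r < (N::nat) \<Longrightarrow> \<phi> r \<in> forms (conf l) j \<and> c r \<in> (\<Union>m. bar_words (conf l) m)"
    unfolding bar_forms_def by blast
  have \<Phi>_eq: "\<Phi> w I = (\<Sum>r<N. \<phi> r I * rconst (c r w))" for w I
    unfolding \<Phi> by (simp add: sum_fun_apply tens_def scale_def mult.commute del: mult_fract)
  show "(\<lambda>I w. \<Phi> w I) \<in> cochains l j"
  proof (rule cochainsI)
    fix I
    show "(\<lambda>w. \<Phi> w I) \<in> W l"
      unfolding \<Phi>_eq
    proof (intro W_sum W_scale)
      fix s assume "s \<in> {..<N}"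
      then have "\<phi> s \<in> forms (conf l) j" "c s \<in> (\<Union>m. bar_words (conf l) m)" using r by auto
      then show "\<phi> s I \<in> O_ring l" "(\<lambda>w. rconst (c s w)) \<in> W l"
        using bar_words_iff_pure pure_W unfolding forms_def by blast+
    qed
    assume I: "\<not> (I \<subseteq> {..<l} \<and> card I = j)"
    have "\<phi> s I = 0" if "s < N" for s
    proof -
      have "\<phi> s \<in> forms (conf l) j" using r that by blast
      then show ?thesis using I unfolding forms_def dim_conf by blast
    qed
    then show "(\<lambda>w. \<Phi> w I) = (\<lambda>w. 0)" unfolding \<Phi>_eq by simp
  qed
next
  assume \<Phi>: "(\<lambda>I w. \<Phi> w I) \<in> cochains l j"
  let ?J = "{I. I \<subseteq> {..<l} \<and> card I = j}"
  have "?J \<subseteq> Pow {..<l}" by blast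
  then have fJ: "finite ?J" by (rule finite_subset) simp
  define \<Psi> where "\<Psi> I w J = (if J = I then \<Phi> w I else 0)" for I w J
  have "\<Phi> = (\<Sum>I\<in>?J. \<Psi> I)"
  proof (intro ext)
    fix w J
    have "(\<Sum>I\<in>?J. \<Psi> I w J) = (\<Sum>I\<in>?J. if I = J then \<Phi> w J else 0)"
      by (intro sum.cong) (auto simp: \<Psi>_def)
    also have "\<dots> = \<Phi> w J"
      using fJ fun_cong[OF cochains_eq_0[OF \<Phi>, of J], of w] by auto
    finally show "\<Phi> w J = (\<Sum>I\<in>?J. \<Psi> I) w J" by (simp only: sum_fun_apply)
  qed
  also have "\<dots> \<in> bar_forms (conf l) j"
  proof (rule bar_forms_sum)
    fix I assume I: "I \<in> ?J"
    have "(\<lambda>w. \<Phi> w I) \<in> W l" using cochains_W[OF \<Phi>] .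
    then obtain B N c where B: "B \<subseteq> O_ring l" "\<And>b n. b \<in> B \<Longrightarrow> c b n \<in> pure l n"
      and eq: "\<And>w. \<Phi> w I = (\<Sum>b\<in>B. \<Sum>n\<le>N. b * c b n w)"
      using W_decompose[of "\<lambda>w. \<Phi> w I" l] by blast
    have "\<forall>b\<in>B. \<forall>n. \<exists>e. e \<in> bar_words (conf l) n \<and> c b n = (\<lambda>w. rconst (e w))"
      using pure_imp_bar_words B(2) by blast
    then obtain e where e: "\<And>b n. b \<in> B \<Longrightarrow> e b n \<in> bar_words (conf l) n"
      "\<And>b n. b \<in> B \<Longrightarrow> c b n = (\<lambda>w. rconst (e b n w))" by metis
    define \<delta> where "\<delta> b J = (if J = I then b else 0)" for b :: "rat ratfun" and J
    have "\<Psi> I = (\<Sum>b\<in>B. \<Sum>n\<le>N. tens (\<delta> b) (e b n))"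
    proof (intro ext)
      fix w J
      have "\<Psi> I w J = (\<Sum>b\<in>B. \<Sum>n\<le>N. rconst (e b n w) * \<delta> b J)"
      proof (cases "J = I")
        case True
        then show ?thesis unfolding \<Psi>_def eq \<delta>_def
          by (auto intro!: sum.cong simp: e(2) mult.commute simp del: mult_fract)
      qed (simp add: \<Psi>_def \<delta>_def)
      then show "\<Psi> I w J = (\<Sum>b\<in>B. \<Sum>n\<le>N. tens (\<delta> b) (e b n)) w J"
        by (simp only: sum_fun_apply tens_def scale_def)
    qed
    moreover have "\<delta> b \<in> forms (conf l) j" if "b \<in> B" for b
      using that B(1) I unfolding forms_def \<delta>_def by auto
    ultimately show "\<Psi> I \<in> bar_forms (conf l) j"
      using e(1) by (auto intro!: bar_forms_sum bar_forms_tens)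
  qed
  finally show "\<Phi> \<in> bar_forms (conf l) j" .
qed

text \<open>In the bar differential the logarithmic form stands on the right of a
  \<open>j\<close>-form. Moving it to the left costs the sign \<open>(-1) ^ j\<close>, which the
  definition of \<open>bar_d\<close> compensates.\<close>

lemma bar_d_eq_koszul_d:
  assumes "\<Phi> \<in> bar_forms (conf l) j"
  shows "bar_d (conf l) j \<Phi> w I = koszul_d l (\<lambda>I w. \<Phi> w I) I w"
proof (cases "finite I")
  case True
  have sign: "(- 1) ^ j * shuffle_sign (I - {i}) {i} * \<Phi> v (I - {i}) = ins_sign i I * \<Phi> v (I - {i})" if i: "i \<in> I" for i v
  proof (cases "card (I - {i}) = j")
    case True
    have "{(a, b). a \<in> I - {i} \<and> b \<in> {i} \<and> b < a} = (\<lambda>b. (b, i)) ` {b \<in> I. i < b}" by auto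
    then have s: "shuffle_sign (I - {i}) {i} = (- 1 :: rat ratfun) ^ card {b \<in> I. i < b}"
      by (simp add: shuffle_sign_def card_image inj_on_def)
    have "I - {i} = {b \<in> I. b < i} \<union> {b \<in> I. i < b}" by auto
    then have "card (I - {i}) = card ({b \<in> I. b < i} \<union> {b \<in> I. i < b})" by (rule arg_cong)
    also have "\<dots> = card {b \<in> I. b < i} + card {b \<in> I. i < b}"
      using \<open>finite I\<close> by (intro card_Un_disjoint) auto
    finally have c: "j = card {b \<in> I. b < i} + card {b \<in> I. i < b}" using True by simp
    have "(- 1 :: rat ratfun) ^ j * (- 1) ^ card {b \<in> I. i < b} =
        (- 1) ^ card {b \<in> I. b < i} * ((- 1) ^ card {b \<in> I. i < b} * (- 1) ^ card {b \<in> I. i < b})"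
      unfolding c power_add by (simp only: mult.assoc)
    also have "\<dots> = ins_sign i I" by (simp add: ins_sign_eq flip: power_add mult_2)
    finally show ?thesis unfolding s by simp
  next
    case False
    then have "\<Phi> v (I - {i}) = 0"
      using cochains_eq_0[OF assms[unfolded bar_forms_iff], of "I - {i}"] by (auto dest: fun_cong)
    then show ?thesis by simp
  qed
  have "bar_d (conf l) j \<Phi> w I = (\<Sum>i\<in>I. ins_sign i I * rdiff i (\<Phi> w (I - {i}))) +
      (\<Sum>a\<in>letters l. \<Sum>i\<in>I. ((- 1) ^ j * shuffle_sign (I - {i}) {i} * \<Phi> (a # w) (I - {i})) * dlog_coeff a i)"
    unfolding bar_d_def ext_d_def hyps_conf plus_fun_apply sum_fun_apply scale_def wedge_omega[OF True]
      sum_distrib_left ins_sign_def by (simp only: mult.assoc)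
  also have "(\<Sum>a\<in>letters l. \<Sum>i\<in>I. ((- 1) ^ j * shuffle_sign (I - {i}) {i} * \<Phi> (a # w) (I - {i})) * dlog_coeff a i) =
      (\<Sum>a\<in>letters l. \<Sum>i\<in>I. ins_sign i I * \<Phi> (a # w) (I - {i}) * dlog_coeff a i)"
    by (intro sum.cong refl arg_cong2[of _ _ _ _ "(*)"] sign)
  also have "\<dots> = (\<Sum>i\<in>I. ins_sign i I * (\<Sum>a\<in>letters l. dlog_coeff a i * \<Phi> (a # w) (I - {i})))"
    unfolding sum_distrib_left by (subst sum.swap) (simp only: mult_ac)
  finally show ?thesis unfolding koszul_d_def nabla_def by (simp only: distrib_left sum.distrib)
next
  case False
  then show ?thesis
    by (simp add: bar_d_def ext_d_def koszul_d_def scale_def wedge_infinite sum_fun_apply)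
qed

lemma cocycles_eq_coboundaries: "cocycles (conf l) (Suc j) = coboundaries (conf l) (Suc j)"
proof (intro equalityI subsetI)
  fix \<Phi> assume "\<Phi> \<in> cocycles (conf l) (Suc j)"
  then have \<Phi>: "\<Phi> \<in> bar_forms (conf l) (Suc j)" and 0: "bar_d (conf l) (Suc j) \<Phi> = 0"
    by (simp_all add: cocycles_def)
  have "koszul_d l (\<lambda>I w. \<Phi> w I) I w = 0" for I w
    using bar_d_eq_koszul_d[OF \<Phi>, of w I] 0 by simp
  then obtain \<Psi> where \<Psi>: "\<Psi> \<in> cochains l j" "koszul_d l \<Psi> = (\<lambda>I w. \<Phi> w I)"
    using koszul_d_exact[OF \<Phi>[unfolded bar_forms_iff] order.refl] by blast
  define \<Psi>' where "\<Psi>' w I = \<Psi> I w" for w I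
  have \<Psi>': "\<Psi>' \<in> bar_forms (conf l) j" using \<Psi>(1) by (simp add: bar_forms_iff \<Psi>'_def)
  have "bar_d (conf l) j \<Psi>' = \<Phi>"
    using fun_cong[OF fun_cong[OF \<Psi>(2)]] by (intro ext) (simp add: bar_d_eq_koszul_d[OF \<Psi>'] \<Psi>'_def)
  then show "\<Phi> \<in> coboundaries (conf l) (Suc j)" using \<Psi>' by (auto simp: coboundaries_def)
next
  fix \<Phi> assume "\<Phi> \<in> coboundaries (conf l) (Suc j)"
  then obtain \<Psi> where \<Psi>: "\<Psi> \<in> bar_forms (conf l) j" "\<Phi> = bar_d (conf l) j \<Psi>"
    by (auto simp: coboundaries_def)
  have c: "(\<lambda>I w. \<Psi> w I) \<in> cochains l j" using \<Psi>(1) by (simp add: bar_forms_iff)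
  have eq: "(\<lambda>I w. \<Phi> w I) = koszul_d l (\<lambda>I w. \<Psi> w I)"
    by (intro ext) (simp add: \<Psi>(2) bar_d_eq_koszul_d[OF \<Psi>(1)])
  then have \<Phi>: "\<Phi> \<in> bar_forms (conf l) (Suc j)"
    unfolding bar_forms_iff using koszul_d_cochains[OF c order.refl] by simp
  have "bar_d (conf l) (Suc j) \<Phi> w I = 0" for w I
    unfolding bar_d_eq_koszul_d[OF \<Phi>] eq by (rule koszul_d_dd) (rule W_V[OF cochains_W[OF c]])
  then show "\<Phi> \<in> cocycles (conf l) (Suc j)" using \<Phi> by (simp add: cocycles_def fun_eq_iff)
qed

lemma cochains_uminus: "\<Phi> \<in> cochains m j \<Longrightarrow> (\<lambda>I w. - \<Phi> I w) \<in> cochains m j"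
  using W_diff[OF W_0] by (intro cochainsI) (force simp: cochains_W cochains_eq_0)+

lemma koszul_d_uminus: "koszul_d l (\<lambda>I w. - \<Phi> I w) I w = - koszul_d l \<Phi> I w"
  using koszul_d_diff[of l "\<lambda>I w. 0" \<Phi> I w] by (simp add: koszul_d_def)

lemma cocycle_group: "comm_group (cocycle_group (conf l) i)"
proof -
  have cocycle_iff: "\<Phi> \<in> cocycles (conf l) i \<longleftrightarrow> \<Phi> \<in> bar_forms (conf l) i \<and> (\<forall>I w. koszul_d l (\<lambda>I w. \<Phi> w I) I w = 0)" for \<Phi>
    unfolding cocycles_def by (auto simp: bar_d_eq_koszul_d fun_eq_iff)
  have add: "\<Phi> + \<Psi> \<in> cocycles (conf l) i" if "\<Phi> \<in> cocycles (conf l) i" "\<Psi> \<in> cocycles (conf l) i" for \<Phi> \<Psi>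
    using that bar_forms_add unfolding cocycle_iff by (auto simp: koszul_d_add)
  have uminus: "- \<Phi> \<in> cocycles (conf l) i" if "\<Phi> \<in> cocycles (conf l) i" for \<Phi>
    using that cochains_uminus unfolding cocycle_iff bar_forms_iff by (auto simp: koszul_d_uminus)
  have zero: "0 \<in> cocycles (conf l) i"
    using bar_forms_0 unfolding cocycle_iff by (auto simp: koszul_d_def)
  show ?thesis
    unfolding cocycle_group_def
    by (rule comm_groupI) (auto simp: add zero add_ac intro: bexI[OF _ uminus])
qed

theorem theorem1p3:
  fixes S :: "'s set" and n l i :: nat
  assumes "n = l + 3" and "n \<ge> 4" and "card S = n" and "i \<ge> 1"
  shows "trivial_group (H_DR (M0 S) i)"
proof -
  let ?G = "cocycle_group (conf l) i"
  interpret G: comm_group ?G by (rule cocycle_group)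
  obtain j where i: "i = Suc j" using assms(4) by (cases i) auto
  \<comment> \<open>Exactness in positive degree: the quotient is by the whole group and has one
    coset.\<close>
  have "coboundaries (conf l) i = carrier ?G"
    unfolding i by (simp add: cocycle_group_def cocycles_eq_coboundaries)
  then have eq: "H_DR (M0 S) i = ?G Mod carrier ?G"
    using assms(1,3) by (simp add: H_DR_def M0_eq_conf)
  have "carrier ?G \<lhd> ?G"
    using G.subgroup_self G.subgroup_imp_normal by blast
  then have "group (?G Mod carrier ?G)" by (rule normal.factorgroup_is_group)
  moreover have "carrier (?G Mod carrier ?G) = {carrier ?G}"
    unfolding carrier_FactGroup using G.coset_join2[OF _ G.subgroup_self] G.one_closed by force
  ultimately show ?thesis unfolding eq trivial_group_def one_FactGroup by blast
qed

end
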